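(* Let $S$ be an ordered abelian monoid, let $\mathbb{Q}S$ be the monoid algebra, and let $\lambda\in\mathbb{Q}$. Then $$\mathrm{Sha}_{\mathbb{Q},\lambda}(\mathbb{Q}S)=\mathbb{Q}S\otimes\mathbb{Q}[\mathrm{Lyn}(S)],$$ where $\mathrm{Lyn}(S)$ is the set of Lyndon words on $S$. In particular, let $X$ be an ordered set and let $M^{c}(X)$ be the free abelian monoid generated by $X$, equipped with a total order. Then $$\mathrm{Sha}_{\mathbb{Q},\lambda}(\mathbb{Q}[X])=\mathbb{Q}[\overline{\mathrm{Lyn}}(M^{c}(X))],\qquad \overline{\mathrm{Lyn}}(M^{c}(X)):=X\cup\{1\otimes w\mid w\in\mathrm{Lyn}(M^{c}(X))\},$$ that is, $\mathrm{Sha}_{\mathbb{Q},\lambda}(\mathbb{Q}[X])$ is the polynomial algebra on $\overline{\mathrm{Lyn}}(M^{c}(X))$.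
   Context: An ordered monoid is a monoid whose underlying set carries a total order $<$. Tensor products are over the base ring. Mixable shuffle algebra: let $\mathbf{k}$ be a commutative ring, $\lambda\in\mathbf{k}$, and $A$ a commutative, not necessarily unital, $\mathbf{k}$-algebra. Then $\mathrm{MS}_{\mathbf{k},\lambda}(A)=\bigoplus_{n\ge 0}A^{\otimes n}$ (with $A^{\otimes 0}=\mathbf{k}$), with the $\mathbf{k}$-bilinear product $\diamond=\diamond_\lambda$ for which $1\in\mathbf{k}$ is the identity and, for pure tensors $\mathfrak{a}=a_1\otimes\mathfrak{a}'$, $\mathfrak{b}=b_1\otimes\mathfrak{b}'$ of lengths $\ge 1$ (where $\mathfrak{a}',\mathfrak{b}'$ may be $1\in\mathbf{k}$, and $a\otimes 1$ is read as $a$), $$\mathfrak{a}\diamond\mathfrak{b}=a_1\otimes(\mathfrak{a}'\diamond\mathfrak{b})+b_1\otimes(\mathfrak{a}\diamond\mathfrak{b}')+\lambda\,(a_1b_1)\otimes(\mathfrak{a}'\diamond\mathfrak{b}').$$ For an abelian semigroup $S$, $\mathrm{MS}_{\mathbf{k},\lambda}(S):=\mathrm{MS}_{\mathbf{k},\lambda}(\mathbf{k}S)$; it is a free module on the words $M^{\otimes}(S)=\{1\}\cup\{u_1\otimes\cdots\otimes u_r\mid u_i\in S,\ r\ge1\}$. For a unital commutative $\mathbf{k}$-algebra $A$, the free commutative Rota-Baxter algebra of weight $\lambda$ on $A$ is the tensor product algebra $\mathrm{Sha}_{\mathbf{k},\lambda}(A)=A\otimes\mathrm{MS}_{\mathbf{k},\lambda}(A)$.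 Elements of $X\subset A=\mathbb{Q}[X]$ are viewed in the first tensor factor. Lexicographic order on $M^{\otimes}(S)$: $u<v$ iff either $v=u\otimes x$ for a non-empty word $x$, or $u=x\otimes a\otimes u'$, $v=x\otimes b\otimes v'$ with words $x,u',v'$ and letters $a<b$. A Lyndon word is a non-empty word $w$ such that $w=u\otimes v$ with $u,v\ne1$ implies $w<v$. $\mathrm{Lyn}(S)$ is the set of Lyndon words. In the first displayed equality, $\mathbb{Q}[\mathrm{Lyn}(S)]$ is the polynomial algebra on $\mathrm{Lyn}(S)$, identified with $\mathrm{MS}_{\mathbb{Q},\lambda}(S)$. *)

theory Defs
  imports Complex_Main "HOL-Library.Poly_Mapping" "HOL-Library.Multiset" "HOL-Algebra.QuotRing" "HOL-Algebra.Module"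
begin

section \<open>Free modules and algebras given on a basis\<close>

text \<open>
  Algebras over a commutative base ring \<open>'k\<close> are records of type \<^typ>\<open>('k, 'a) module\<close>;
  the base ring itself is a type.  The free module on a set \<open>B\<close> consists of the
  finitely supported functions \<^typ>\<open>'b \<Rightarrow>\<^sub>0 'k\<close> with support in \<open>B\<close>.
\<close>

abbreviation basis :: "'b \<Rightarrow> ('b \<Rightarrow>\<^sub>0 'k::comm_ring_1)"
  where "basis b \<equiv> Poly_Mapping.single b 1"

definition scale :: "'k::comm_ring_1 \<Rightarrow> ('b \<Rightarrow>\<^sub>0 'k) \<Rightarrow> ('b \<Rightarrow>\<^sub>0 'k)"
  where "scale c p = Poly_Mapping.map ((*) c) p"

lemma lookup_scale: "Poly_Mapping.lookup (scale c p) b = c * Poly_Mapping.lookup p b"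
  by (simp add: scale_def Poly_Mapping.map.rep_eq when_def)

lemma module_scale: "Modules.module scale"
  by standard (auto intro!: poly_mapping_eqI simp: lookup_scale lookup_add algebra_simps)

definition lin_ext :: "('b \<Rightarrow> ('c \<Rightarrow>\<^sub>0 'k)) \<Rightarrow> ('b \<Rightarrow>\<^sub>0 'k::comm_ring_1) \<Rightarrow> ('c \<Rightarrow>\<^sub>0 'k)"
  where "lin_ext f p = (\<Sum>b\<in>Poly_Mapping.keys p. scale (Poly_Mapping.lookup p b) (f b))"

text \<open>The free module on \<open>B\<close>, with the bilinear extension of \<open>m\<close> as product and \<open>basis e\<close> as unit.\<close>

definition basis_alg ::
    "'b set \<Rightarrow> ('b \<Rightarrow> 'b \<Rightarrow> ('b \<Rightarrow>\<^sub>0 'k)) \<Rightarrow> 'b \<Rightarrow> ('k::comm_ring_1, 'b \<Rightarrow>\<^sub>0 'k) module"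
  where "basis_alg B m e =
    \<lparr>carrier = {p. Poly_Mapping.keys p \<subseteq> B},
     monoid.mult = (\<lambda>p q. lin_ext (\<lambda>b. lin_ext (\<lambda>c. m b c) q) p),
     one = basis e, ring.zero = 0, ring.add = (+), smult = scale\<rparr>"

definition quotient_alg ::
    "('k, 'a) module \<Rightarrow> 'a set \<Rightarrow> ('k, 'a set) module"
  where "quotient_alg A I =
    ring.extend (A Quot I) \<lparr>smult = (\<lambda>c U. \<Union>x\<in>U. I +>\<^bsub>A\<^esub> (c \<odot>\<^bsub>A\<^esub> x))\<rparr>"

definition alg_iso :: "('k, 'a) module \<Rightarrow> ('k, 'b) module \<Rightarrow> ('a \<Rightarrow> 'b) set"
  where "alg_iso A B =
    {f \<in> ring_iso A B. \<forall>c. \<forall>x\<in>carrier A. f (c \<odot>\<^bsub>A\<^esub> x) = c \<odot>\<^bsub>B\<^esub> f x}"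


section \<open>Monoid algebras and polynomial algebras\<close>

definition monoid_alg :: "('s, 'm) monoid_scheme \<Rightarrow> ('k::comm_ring_1, 's \<Rightarrow>\<^sub>0 'k) module"
  where "monoid_alg S = basis_alg (carrier S) (\<lambda>s t. basis (s \<otimes>\<^bsub>S\<^esub> t)) (\<one>\<^bsub>S\<^esub>)"

definition free_comm_monoid :: "'x set \<Rightarrow> 'x multiset monoid"
  where "free_comm_monoid X = \<lparr>carrier = {m. set_mset m \<subseteq> X}, monoid.mult = (+), one = {#}\<rparr>"

abbreviation polynomial_alg :: "'x set \<Rightarrow> ('k::comm_ring_1, 'x multiset \<Rightarrow>\<^sub>0 'k) module"
  where "polynomial_alg X \<equiv> monoid_alg (free_comm_monoid X)"

abbreviation variable :: "'x \<Rightarrow> ('x multiset \<Rightarrow>\<^sub>0 'k::comm_ring_1)"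
  where "variable x \<equiv> basis {#x#}"

text \<open>
  \<open>A\<close> is the polynomial algebra on its subset \<open>Y\<close>: the evaluation homomorphism from the
  polynomial ring in indeterminates \<open>Y\<close> to \<open>A\<close>, sending each indeterminate \<open>y\<close> to the
  element \<open>y\<close>, is an isomorphism.
\<close>

definition is_polynomial_alg_on :: "('k::comm_ring_1, 'a) module \<Rightarrow> 'a set \<Rightarrow> bool"
  where "is_polynomial_alg_on A Y \<longleftrightarrow>
    Y \<subseteq> carrier A \<and> (\<exists>f \<in> alg_iso (polynomial_alg Y) A. \<forall>y\<in>Y. f (variable y) = y)"


section \<open>Tensor product of two algebras\<close>

text \<open>
  The free module on \<open>A \<times> B\<close>, with \<open>(a, b) (a', b') = (a a', b b')\<close>, modulo the submodule
  generated by the bilinearity relations.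
\<close>

definition pairs_alg ::
    "('k::comm_ring_1, 'a) module \<Rightarrow> ('k, 'b) module \<Rightarrow> ('k, 'a \<times> 'b \<Rightarrow>\<^sub>0 'k) module"
  where "pairs_alg A B =
    basis_alg (carrier A \<times> carrier B)
      (\<lambda>x y. basis (fst x \<otimes>\<^bsub>A\<^esub> fst y, snd x \<otimes>\<^bsub>B\<^esub> snd y)) (\<one>\<^bsub>A\<^esub>, \<one>\<^bsub>B\<^esub>)"

definition tensor_relations ::
    "('k::comm_ring_1, 'a) module \<Rightarrow> ('k, 'b) module \<Rightarrow> ('a \<times> 'b \<Rightarrow>\<^sub>0 'k) set"
  where "tensor_relations A B =
      {basis (a \<oplus>\<^bsub>A\<^esub> a', b) - basis (a, b) - basis (a', b) | a a' b.
         a \<in> carrier A \<and> a' \<in> carrier A \<and> b \<in> carrier B}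
    \<union> {basis (a, b \<oplus>\<^bsub>B\<^esub> b') - basis (a, b) - basis (a, b') | a b b'.
         a \<in> carrier A \<and> b \<in> carrier B \<and> b' \<in> carrier B}
    \<union> {basis (c \<odot>\<^bsub>A\<^esub> a, b) - scale c (basis (a, b)) | c a b.
         a \<in> carrier A \<and> b \<in> carrier B}
    \<union> {basis (a, c \<odot>\<^bsub>B\<^esub> b) - scale c (basis (a, b)) | c a b.
         a \<in> carrier A \<and> b \<in> carrier B}"

definition tensor_kernel ::
    "('k::comm_ring_1, 'a) module \<Rightarrow> ('k, 'b) module \<Rightarrow> ('a \<times> 'b \<Rightarrow>\<^sub>0 'k) set"
  where "tensor_kernel A B = Modules.module.span scale (tensor_relations A B)"

definition tensor_alg ::
    "('k::comm_ring_1, 'a) module \<Rightarrow> ('k, 'b) module \<Rightarrow> ('k, ('a \<times> 'b \<Rightarrow>\<^sub>0 'k) set) module"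
  where "tensor_alg A B = quotient_alg (pairs_alg A B) (tensor_kernel A B)"

definition pure_tensor ::
    "('k::comm_ring_1, 'a) module \<Rightarrow> ('k, 'b) module \<Rightarrow> 'a \<Rightarrow> 'b \<Rightarrow> ('a \<times> 'b \<Rightarrow>\<^sub>0 'k) set"
  where "pure_tensor A B a b = tensor_kernel A B +>\<^bsub>pairs_alg A B\<^esub> basis (a, b)"


section \<open>Mixable shuffle algebra and free commutative Rota-Baxter algebra\<close>

text \<open>
  \<^term>\<open>lin_ext (\<lambda>w. basis (a # w)) p\<close> is \<open>a \<otimes> p\<close>; the empty word is \<open>1\<close>, so that
  \<open>a \<otimes> 1 = a\<close> is the one-letter word.
\<close>

fun mixable_shuffle :: "('a \<Rightarrow> 'a \<Rightarrow> 'a) \<Rightarrow> 'k::comm_ring_1 \<Rightarrow> 'a list \<Rightarrow> 'a list \<Rightarrow> ('a list \<Rightarrow>\<^sub>0 'k)"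
  where
    "mixable_shuffle m lam [] bs = basis bs"
  | "mixable_shuffle m lam (a # as) [] = basis (a # as)"
  | "mixable_shuffle m lam (a # as) (b # bs) =
       lin_ext (\<lambda>w. basis (a # w)) (mixable_shuffle m lam as (b # bs))
     + lin_ext (\<lambda>w. basis (b # w)) (mixable_shuffle m lam (a # as) bs)
     + scale lam (lin_ext (\<lambda>w. basis (m a b # w)) (mixable_shuffle m lam as bs))"

text \<open>
  The direct sum of all tensor powers of \<open>A\<close> is the free module on the words over \<open>A\<close>
  modulo the submodule generated by the multilinearity relations (which are homogeneous
  in the length of words).  The unit of \<open>A\<close> is not used.
\<close>

definition words_alg ::
    "'k \<Rightarrow> ('k::comm_ring_1, 'a) module \<Rightarrow> ('k, 'a list \<Rightarrow>\<^sub>0 'k) module"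
  where "words_alg lam A =
    basis_alg (lists (carrier A)) (mixable_shuffle (\<lambda>a b. a \<otimes>\<^bsub>A\<^esub> b) lam) []"

definition multilinear_relations :: "('k::comm_ring_1, 'a) module \<Rightarrow> ('a list \<Rightarrow>\<^sub>0 'k) set"
  where "multilinear_relations A =
      {basis (u @ (a \<oplus>\<^bsub>A\<^esub> a') # v) - basis (u @ a # v) - basis (u @ a' # v) | u v a a'.
         u \<in> lists (carrier A) \<and> v \<in> lists (carrier A) \<and> a \<in> carrier A \<and> a' \<in> carrier A}
    \<union> {basis (u @ (c \<odot>\<^bsub>A\<^esub> a) # v) - scale c (basis (u @ a # v)) | u v c a.
         u \<in> lists (carrier A) \<and> v \<in> lists (carrier A) \<and> a \<in> carrier A}"

definition multilinear_kernel :: "('k::comm_ring_1, 'a) module \<Rightarrow> ('a list \<Rightarrow>\<^sub>0 'k) set"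
  where "multilinear_kernel A = Modules.module.span scale (multilinear_relations A)"

definition MS :: "'k \<Rightarrow> ('k::comm_ring_1, 'a) module \<Rightarrow> ('k, ('a list \<Rightarrow>\<^sub>0 'k) set) module"
  where "MS lam A = quotient_alg (words_alg lam A) (multilinear_kernel A)"

text \<open>The pure tensor \<open>a\<^sub>1 \<otimes> \<dots> \<otimes> a\<^sub>n\<close>; the underlying coset does not depend on \<open>lam\<close>.\<close>

definition MS_pure :: "'k \<Rightarrow> ('k::comm_ring_1, 'a) module \<Rightarrow> 'a list \<Rightarrow> ('a list \<Rightarrow>\<^sub>0 'k) set"
  where "MS_pure lam A as = multilinear_kernel A +>\<^bsub>words_alg lam A\<^esub> basis as"

definition Sha ::
    "'k \<Rightarrow> ('k::comm_ring_1, 'a) module \<Rightarrow> ('k, ('a \<times> ('a list \<Rightarrow>\<^sub>0 'k) set \<Rightarrow>\<^sub>0 'k) set) module"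
  where "Sha lam A = tensor_alg A (MS lam A)"

definition Sha_pure ::
    "'k \<Rightarrow> ('k::comm_ring_1, 'a) module \<Rightarrow> 'a \<Rightarrow> ('a list \<Rightarrow>\<^sub>0 'k) set
      \<Rightarrow> ('a \<times> ('a list \<Rightarrow>\<^sub>0 'k) set \<Rightarrow>\<^sub>0 'k) set"
  where "Sha_pure lam A = pure_tensor A (MS lam A)"

text \<open>A word \<open>u\<^sub>1 \<otimes> \<dots> \<otimes> u\<^sub>r\<close> over a monoid \<open>S\<close>, as an element of \<^term>\<open>MS lam (monoid_alg S)\<close>.\<close>

definition MS_word :: "'k \<Rightarrow> ('s, 'm) monoid_scheme \<Rightarrow> 's list \<Rightarrow> (('s \<Rightarrow>\<^sub>0 'k::comm_ring_1) list \<Rightarrow>\<^sub>0 'k) set"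
  where "MS_word lam S w = MS_pure lam (monoid_alg S) (map basis w)"


section \<open>Lyndon words\<close>

text \<open>
  The order \<open>r\<close> is given as a reflexive relation, hence \<^term>\<open>lexord (r - Id)\<close> is the strict
  lexicographic order.
\<close>

definition Lyn :: "('s, 'm) monoid_scheme \<Rightarrow> ('s \<times> 's) set \<Rightarrow> 's list set"
  where "Lyn S r =
    {w \<in> lists (carrier S). w \<noteq> [] \<and>
       (\<forall>u v. w = u @ v \<and> u \<noteq> [] \<and> v \<noteq> [] \<longrightarrow> (w, v) \<in> lexord (r - Id))}"

text \<open>The set \<open>X \<union> {1 \<otimes> w | w \<in> Lyn(M\<^sup>c(X))}\<close>, where \<open>x \<in> X\<close> stands for \<open>x \<otimes> 1\<close>.\<close>

definition Lyn_bar ::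
    "'k \<Rightarrow> 'x set \<Rightarrow> ('x multiset \<times> 'x multiset) set \<Rightarrow>
      (('x multiset \<Rightarrow>\<^sub>0 'k) \<times> (('x multiset \<Rightarrow>\<^sub>0 'k) list \<Rightarrow>\<^sub>0 'k) set \<Rightarrow>\<^sub>0 'k::comm_ring_1) set set"
  where "Lyn_bar lam X r =
      {Sha_pure lam (polynomial_alg X) (variable x) \<one>\<^bsub>MS lam (polynomial_alg X)\<^esub> | x. x \<in> X}
    \<union> {Sha_pure lam (polynomial_alg X) \<one>\<^bsub>polynomial_alg X\<^esub>
         (MS_word lam (free_comm_monoid X) w) | w. w \<in> Lyn (free_comm_monoid X) r}"

end

theory Submission
  imports Defs
begin

text \<open>
  Let \<open>W\<close> be the free module on the words over \<open>S\<close> with the mixable shuffle product \<open>\<diamondop>\<close>.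
  Expanding every tensor factor in the basis \<open>S\<close> identifies the mixable shuffle algebra of the
  monoid algebra with \<open>W\<close>, so the first claim says that \<open>W\<close> is the polynomial algebra on the
  Lyndon words. This is Radford's theorem on shuffle algebras in a filtered form.

  The product \<open>u \<diamondop> v\<close> of two words is the sum of their shuffles plus shorter words; the weight
  and the multiplication of \<open>S\<close> enter the shorter words only. Order words by length and then
  lexicographically. For Lyndon words \<open>l\<^sub>1 \<ge> \<dots> \<ge> l\<^sub>k\<close> the largest word of \<open>l\<^sub>1 \<diamondop> \<dots> \<diamondop> l\<^sub>k\<close> is
  the concatenation \<open>l\<^sub>1 \<dots> l\<^sub>k\<close>, and its coefficient counts shuffles, so it is positive and
  invertible. Every word is such a concatenation in exactly one way (Chen, Fox and Lyndon).
  Hence the matrix that expresses the products of Lyndon words through words is triangular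
  with invertible diagonal, and these products form a basis of \<open>W\<close>.

  The combinatorial core is \<open>shuffles_lyndon_le\<close>, which determines the largest shuffle. It
  rests on a greedy principle: a largest shuffle of two words may always start with the first
  letter of the larger one. The principle follows from an exchange argument,
  \<open>shuffles_exchange\<close>.

  The rest is transport along quotients. Tensor powers and tensor products are free modules
  modulo multilinearity relations. Every generator is congruent to its expansion in basis
  elements, so the relations are exactly the kernel of the expansion map, and
  \<open>quotient_basis_alg\<close> turns that map into an isomorphism. In this way the tensor product of
  \<open>kS\<close> with any algebra isomorphic to \<open>kT\<close> becomes \<open>k(S \<times> T)\<close> (\<open>tensor_monoid_alg\<close>). The
  isomorphism onto the free commutative Rota-Baxter algebra compares two such tensor products.
  For the last claim, a multiset over a disjoint union is a pair of multisets, so a tensor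
  product of polynomial algebras is the polynomial algebra on both sets of variables
  (\<open>polynomial_alg_tensor\<close>).
\<close>


section \<open>Lyndon words and the largest shuffle\<close>

locale alphabet_order =
  fixes R :: "'a rel"
  assumes trans_R: "trans R" and irrefl_R: "(a, a) \<notin> R"
    and total_R: "a \<noteq> b \<Longrightarrow> (a, b) \<in> R \<or> (b, a) \<in> R"
begin

definition word_less :: "'a list \<Rightarrow> 'a list \<Rightarrow> bool" (infix \<open>\<prec>\<close> 50)
  where "u \<prec> v \<longleftrightarrow> (u, v) \<in> lexord R"

definition word_le :: "'a list \<Rightarrow> 'a list \<Rightarrow> bool" (infix \<open>\<preceq>\<close> 50)
  where "u \<preceq> v \<longleftrightarrow> u \<prec> v \<or> u = v"

text \<open>
  A word lies below another one either as a proper prefix or at a first differing letter. Only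
  the second case survives appending arbitrary words on both sides, which is what comparisons
  of shuffles need; hence the separate relation.
\<close>

definition differs_below :: "'a list \<Rightarrow> 'a list \<Rightarrow> bool" (infix \<open>\<lless>\<close> 50)
  where "u \<lless> v \<longleftrightarrow> (\<exists>c a b d e. u = c @ a # d \<and> v = c @ b # e \<and> (a, b) \<in> R)"

sublocale words: linorder word_le word_less
proof
  fix x y z :: "'a list"
  have irr: "\<not> x \<prec> x" for x
    using irrefl_R by (simp add: word_less_def lexord_irreflexive)
  have tr: "x \<prec> y \<Longrightarrow> y \<prec> z \<Longrightarrow> x \<prec> z" for x y z
    unfolding word_less_def by (rule lexord_trans[OF _ _ trans_R])
  show "(x \<prec> y) = (x \<preceq> y \<and> \<not> y \<preceq> x)"
    using irr tr unfolding word_le_def by blast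
  show "x \<preceq> x" by (simp add: word_le_def)
  show "x \<preceq> y \<Longrightarrow> y \<preceq> z \<Longrightarrow> x \<preceq> z" using tr unfolding word_le_def by blast
  show "x \<preceq> y \<Longrightarrow> y \<preceq> x \<Longrightarrow> x = y" using irr tr unfolding word_le_def by blast
  show "x \<preceq> y \<or> y \<preceq> x"
    using lexord_linear[of R x y] total_R unfolding word_le_def word_less_def by blast
qed

lemma Nil_less [simp]: "[] \<prec> v \<longleftrightarrow> v \<noteq> []"
  by (cases v) (auto simp: word_less_def)

lemma Cons_less_Cons: "a # u \<prec> b # v \<longleftrightarrow> (a, b) \<in> R \<or> a = b \<and> u \<prec> v"
  by (simp add: word_less_def)

lemma append_less_append [simp]: "c @ u \<prec> c @ v \<longleftrightarrow> u \<prec> v"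
  by (induction c) (auto simp: Cons_less_Cons irrefl_R)

lemma append_le_append [simp]: "c @ u \<preceq> c @ v \<longleftrightarrow> u \<preceq> v"
  by (auto simp: word_le_def)

lemma Cons_le_Cons_same [simp]: "a # u \<preceq> a # v \<longleftrightarrow> u \<preceq> v"
  using append_le_append[of "[a]"] by simp

lemma prefix_le [simp]: "u \<preceq> u @ v"
  using append_le_append[of u "[]" v] by (simp add: word_le_def del: append_le_append)

lemma differs_below_append: "u \<lless> v \<Longrightarrow> u @ x \<lless> v @ y"
  unfolding differs_below_def by fastforce

lemma differs_below_Cons: "u \<lless> v \<Longrightarrow> a # u \<lless> a # v"
  unfolding differs_below_def by (metis append_Cons)

lemma differs_belowI: "(a, b) \<in> R \<Longrightarrow> a # u \<lless> b # v"
  unfolding differs_below_def by (metis append_Nil)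

lemma differs_below_imp_less: "u \<lless> v \<Longrightarrow> u \<prec> v"
  unfolding differs_below_def by (auto simp: Cons_less_Cons)

lemma less_cases:
  assumes "u \<prec> v"
  obtains (diff) "u \<lless> v" | (prefix) y where "v = u @ y" "y \<noteq> []"
proof -
  have "u \<lless> v \<or> (\<exists>y. v = u @ y \<and> y \<noteq> [])"
    using assms unfolding word_less_def lexord_def differs_below_def by blast
  then show thesis using that by blast
qed

lemma less_same_length: "u \<prec> v \<Longrightarrow> length v \<le> length u \<Longrightarrow> u \<lless> v"
  by (erule less_cases) auto

lemma append_le_cases:
  assumes "q @ q' \<preceq> p"
  obtains (diff) "q \<lless> p" | (prefix) p' where "p = q @ p'" "q' \<preceq> p'"
proof (cases "q \<lless> p")
  case False
  have "q \<preceq> p" using assms words.order_trans prefix_le by blast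
  then have "\<exists>p'. p = q @ p'"
    using False less_cases unfolding word_le_def by (metis append_Nil2)
  then show thesis using assms prefix by auto
qed (rule diff)

lemma shuffles_append_split:
  "x \<in> shuffles (s @ p) q \<Longrightarrow>
    \<exists>q1 q2 y z. q = q1 @ q2 \<and> x = y @ z \<and> y \<in> shuffles s q1 \<and> z \<in> shuffles p q2"
proof (induction s q arbitrary: x rule: shuffles.induct)
  case (1 ys)
  then show ?case by (metis Nil_in_shufflesI append_Nil)
next
  case (2 xs)
  then show ?case by (fastforce intro: exI[of _ xs])
next
  case (3 a s b q)
  from 3(3) consider x' where "x = a # x'" "x' \<in> shuffles (s @ p) (b # q)"
    | x' where "x = b # x'" "x' \<in> shuffles ((a # s) @ p) q" by auto
  then show ?case
  proof cases
    case 1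
    from 3(1)[OF 1(2)] obtain q1 q2 y z
      where "b # q = q1 @ q2" "x' = y @ z" "y \<in> shuffles s q1" "z \<in> shuffles p q2" by blast
    then show ?thesis using 1(1) Cons_in_shuffles_leftI by (metis append_Cons)
  next
    case 2
    from 3(2)[OF 2(2)] obtain q1 q2 y z
      where "q = q1 @ q2" "x' = y @ z" "y \<in> shuffles (a # s) q1" "z \<in> shuffles p q2" by blast
    then show ?thesis using 2(1) Cons_in_shuffles_rightI by (metis append_Cons)
  qed
qed

lemma append_in_shuffles:
  "y \<in> shuffles s q1 \<Longrightarrow> z \<in> shuffles p q2 \<Longrightarrow> y @ z \<in> shuffles (s @ p) (q1 @ q2)"
proof (induction s q1 arbitrary: y rule: shuffles.induct)
  case (1 ys)
  then have "y = ys" by simp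
  have "ys @ z \<in> shuffles p (ys @ q2)"
    by (induction ys) (auto intro: 1 Cons_in_shuffles_rightI)
  then show ?case using \<open>y = ys\<close> by simp
next
  case (2 xs)
  then have "y = xs" by simp
  have "xs @ z \<in> shuffles (xs @ p) q2"
    by (induction xs) (auto intro: 2 Cons_in_shuffles_leftI)
  then show ?case using \<open>y = xs\<close> by simp
next
  case (3 x xs y' ys)
  then show ?case by (auto intro: Cons_in_shuffles_leftI Cons_in_shuffles_rightI)
qed

text \<open>
  Put the letters of \<open>v'\<close> at the places of the letters of \<open>v\<close> in \<open>x\<close>. The first difference of
  \<open>v\<close> and \<open>v'\<close> becomes the first difference of the results, and what follows it is irrelevant;
  therefore \<open>v\<close> and \<open>v'\<close> may differ in length.
\<close>

lemma shuffles_differs_below: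
  "x \<in> shuffles u v \<Longrightarrow> v \<lless> v' \<Longrightarrow> \<exists>x'\<in>shuffles u v'. x \<lless> x'"
proof (induction u v arbitrary: x v' rule: shuffles.induct)
  case (1 v)
  then show ?case by auto
next
  case (2 u)
  then show ?case by (auto simp: differs_below_def)
next
  case (3 a u b v)
  from 3(4) obtain b' w where v': "v' = b' # w" and bw: "(b, b') \<in> R \<or> b = b' \<and> v \<lless> w"
    unfolding differs_below_def by (fastforce simp: Cons_eq_append_conv)
  from 3(3) consider x' where "x = a # x'" "x' \<in> shuffles u (b # v)"
    | x' where "x = b # x'" "x' \<in> shuffles (a # u) v" by auto
  then show ?case
  proof cases
    case 1
    then show ?thesis using 3(1)[OF 1(2) 3(4)] v'
      by (auto intro: differs_below_Cons Cons_in_shuffles_leftI)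
  next
    case 2
    from bw show ?thesis
    proof
      assume "(b, b') \<in> R"
      \<comment> \<open>The difference is decided here, so any continuation will do.\<close>
      moreover have "(a # u) @ w \<in> shuffles (a # u) w"
        using append_in_shuffles[of "a # u" "a # u" "[]" w "[]" w] by simp
      ultimately show ?thesis
        using 2 v' by (auto intro!: bexI[of _ "b' # (a # u) @ w"] differs_belowI)
    next
      assume "b = b' \<and> v \<lless> w"
      then show ?thesis using 3(2)[OF 2(2), of w] 2 v'
        by (auto intro: differs_below_Cons Cons_in_shuffles_rightI)
    qed
  qed
qed

text \<open>
  For a large shuffle, a word \<open>s\<close> is better put in front of the smaller one of two words.
  Until \<open>s\<close> is used up, \<open>x\<close> interleaves it with some prefix \<open>q\<^sub>1\<close> of \<open>q\<close>. If \<open>p\<close> beats \<open>q\<^sub>1\<close>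
  at some letter, then interleaving \<open>s\<close> with \<open>p\<close> instead gives a larger word. Otherwise \<open>p\<close>
  starts with \<open>q\<^sub>1\<close> as well, and the remaining letters pose the same problem with \<open>q\<^sub>1\<close> in the
  role of \<open>s\<close>.
\<close>

lemma shuffles_exchange:
  "x \<in> shuffles (s @ p) q \<Longrightarrow> q \<preceq> p \<Longrightarrow> \<exists>x'\<in>shuffles p (s @ q). x \<preceq> x'"
proof (induction "length s + length p + length q" arbitrary: s p q x rule: less_induct)
  case less
  show ?case
  proof (cases "s = []")
    case True
    then show ?thesis using less.prems(1) by auto
  next
    case False
    from shuffles_append_split[OF less.prems(1)] obtain q1 q2 y z
      where q: "q = q1 @ q2" and x: "x = y @ z" and y: "y \<in> shuffles s q1"
        and z: "z \<in> shuffles p q2" by blast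
    from less.prems(2)[unfolded q] show ?thesis
    proof (cases rule: append_le_cases)
      case diff
      from shuffles_differs_below[OF y diff] obtain y'
        where y': "y' \<in> shuffles s p" "y \<lless> y'" by blast
      have "y' @ q \<in> shuffles (p @ []) (s @ q)"
        using y' by (intro append_in_shuffles) (auto simp: shuffles_commutes)
      then show ?thesis using differs_below_append[OF y'(2), of z q] x
        by (auto simp: word_le_def dest: differs_below_imp_less)
    next
      case (prefix p')
      have "length q1 + length p' + length q2 < length s + length p + length q"
        using False by (auto simp: q prefix)
      from less.hyps[OF this z[unfolded prefix(1)] prefix(2)]
      obtain z' where z': "z' \<in> shuffles p' (q1 @ q2)" "z \<preceq> z'" by blast
      have "y @ z' \<in> shuffles (q1 @ p') (s @ q)"
        using y z' by (intro append_in_shuffles) (auto simp: shuffles_commutes q)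
      then show ?thesis using z'(2) x prefix(1) by (auto intro!: bexI[of _ "y @ z'"])
    qed
  qed
qed

text \<open>
  The greedy principle. Before \<open>a\<close> is taken, \<open>x\<close> spells out a prefix \<open>q\<^sub>1\<close> of \<open>q\<close>. Either
  \<open>a # p\<close> beats \<open>q\<^sub>1\<close> at some letter, and then starting with \<open>a # p\<close> is better, or \<open>a # p\<close>
  starts with \<open>q\<^sub>1\<close> too, and the exchange lemma lets \<open>a # p\<close> supply these letters.
\<close>

lemma shuffles_greedy_step:
  assumes "x \<in> shuffles (a # p) q" "q \<preceq> a # p"
  shows "\<exists>x'\<in>shuffles p q. x \<preceq> a # x'"
proof -
  have "x \<in> shuffles (a # p) q \<Longrightarrow>
    \<exists>q1 q2 z. q = q1 @ q2 \<and> x = q1 @ a # z \<and> z \<in> shuffles p q2" for x q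
  proof (induction q arbitrary: x)
    case (Cons b q)
    from Cons.prems consider x' where "x = a # x'" "x' \<in> shuffles p (b # q)"
      | x' where "x = b # x'" "x' \<in> shuffles (a # p) q" by auto
    then show ?case
    proof cases
      case 1
      then show ?thesis by (metis append_Nil)
    next
      case 2
      then show ?thesis using Cons.IH[OF 2(2)] by (metis append_Cons)
    qed
  qed auto
  from this[OF assms(1)] obtain q1 q2 z
    where q: "q = q1 @ q2" and x: "x = q1 @ a # z" and z: "z \<in> shuffles p q2" by blast
  from assms(2)[unfolded q] show ?thesis
  proof (cases rule: append_le_cases)
    case diff
    have "p @ q \<in> shuffles p q"
      using append_in_shuffles[of p p "[]" q "[]" q] by simp
    then show ?thesis using differs_below_append[OF diff, of "a # z" q] x
      by (auto simp: word_le_def dest: differs_below_imp_less)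
  next
    case (prefix p')
    show ?thesis
    proof (cases q1)
      case Nil
      then show ?thesis using x z q by auto
    next
      case (Cons b q1')
      have ba: "b = a" and p: "p = q1' @ p'" using prefix Cons by auto
      have "a # z \<in> shuffles (q1 @ p') q2"
        using z prefix(1) by (metis Cons_in_shuffles_leftI)
      from shuffles_exchange[OF this prefix(2)] obtain z'
        where z': "z' \<in> shuffles p' (q1 @ q2)" "a # z \<preceq> z'" by blast
      have "q1' @ z' \<in> shuffles (q1' @ p') ([] @ q)"
        using z' by (intro append_in_shuffles) (auto simp: q)
      then show ?thesis using z'(2) x Cons ba p
        by (intro bexI[of _ "q1' @ z'"]) auto
    qed
  qed
qed

text \<open>
  As long as the unused part of \<open>u\<close>, followed by \<open>w\<close>, is not below \<open>v\<close>, the greedy principle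
  keeps taking letters of \<open>u\<close>.
\<close>

lemma shuffles_greedy:
  assumes "x \<in> shuffles (u @ w) v"
    and "\<And>u1 u2. u = u1 @ u2 \<Longrightarrow> u2 \<noteq> [] \<Longrightarrow> v \<preceq> u2 @ w"
  shows "\<exists>z\<in>shuffles w v. x \<preceq> u @ z"
  using assms
proof (induction u arbitrary: x)
  case (Cons a u)
  have "v \<preceq> a # u @ w" using Cons.prems(2)[of "[]" "a # u"] by simp
  from shuffles_greedy_step[OF _ this] Cons.prems(1)
  obtain x' where x': "x' \<in> shuffles (u @ w) v" "x \<preceq> a # x'" by auto
  have "\<exists>z\<in>shuffles w v. x' \<preceq> u @ z"
    using Cons.prems(2)[of "a # _"] by (intro Cons.IH x') auto
  then obtain z where "z \<in> shuffles w v" "a # x' \<preceq> (a # u) @ z" by auto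
  then show ?case using x'(2) words.order_trans by blast
qed (auto simp: word_le_def)

definition lyndon :: "'a list \<Rightarrow> bool"
  where "lyndon w \<longleftrightarrow> w \<noteq> [] \<and> (\<forall>u v. w = u @ v \<and> u \<noteq> [] \<and> v \<noteq> [] \<longrightarrow> w \<prec> v)"

lemma lyndon_suffix_le: "lyndon (u @ v) \<Longrightarrow> v \<noteq> [] \<Longrightarrow> u @ v \<preceq> v"
  unfolding lyndon_def word_le_def by (metis append_Nil)

lemma lyndon_singleton: "lyndon [a]"
  by (auto simp: lyndon_def Cons_eq_append_conv)

text \<open>
  A proper suffix \<open>u'\<close> of \<open>u\<close> is shorter than \<open>u\<close>, so \<open>u \<prec> u'\<close> is decided at a letter and
  survives appending \<open>v\<close>. For the suffix \<open>v\<close> itself the only difficult case is \<open>v = u @ y\<close>;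
  there \<open>v \<prec> y\<close>, and prepending \<open>u\<close> to both sides gives \<open>u @ v \<prec> v\<close>.
\<close>

lemma lyndon_append:
  assumes u: "lyndon u" and v: "lyndon v" and "u \<prec> v"
  shows "lyndon (u @ v)"
  unfolding lyndon_def
proof (intro conjI allI impI)
  show "u @ v \<noteq> []" using u by (simp add: lyndon_def)
  have uv: "u @ v \<prec> v"
    using \<open>u \<prec> v\<close>
  proof (cases rule: less_cases)
    case diff
    from differs_below_append[OF this, of v "[]"] show ?thesis
      by (simp add: differs_below_imp_less)
  next
    case (prefix y)
    then have "v \<prec> y" using u v by (auto simp: lyndon_def)
    then show ?thesis using prefix by (metis append_less_append)
  qed
  fix s t assume st: "u @ v = s @ t \<and> s \<noteq> [] \<and> t \<noteq> []"
  then consider u' where "u = s @ u'" "t = u' @ v" | v' where "v = v' @ t"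
    by (auto simp: append_eq_append_conv2)
  then show "u @ v \<prec> t"
  proof cases
    case (1 u')
    show ?thesis
    proof (cases "u' = []")
      case False
      then have "u \<prec> u'" using u 1 st by (auto simp: lyndon_def)
      then have "u \<lless> u'" using 1 by (intro less_same_length) auto
      from differs_below_append[OF this, of v v] show ?thesis
        using 1 by (simp add: differs_below_imp_less)
    qed (use uv 1 in simp)
  next
    case (2 v')
    then have "v \<preceq> t" using lyndon_suffix_le v st by metis
    then show ?thesis using uv by (rule words.less_le_trans[rotated])
  qed
qed

abbreviation nonincreasing :: "'a list list \<Rightarrow> bool"
  where "nonincreasing \<equiv> sorted_wrt (\<lambda>u v. v \<preceq> u)"

text \<open>
  A factor below \<open>u\<close> either loses at some letter, which settles the comparison, or is a proper
  prefix of \<open>u\<close>. In the second case it cancels and leaves a shorter non-empty suffix of the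
  same Lyndon word, which is again above all remaining factors.
\<close>

lemma lyndon_suffix_dominates:
  assumes "lyndon (u0 @ u)" "u \<noteq> []" "\<And>l. l \<in> set ls \<Longrightarrow> l \<prec> u0 @ u"
  shows "concat ls \<prec> u"
  using assms
proof (induction ls arbitrary: u0 u)
  case (Cons l ls)
  have "l \<prec> u"
    using Cons.prems lyndon_suffix_le words.less_le_trans by (metis list.set_intros(1))
  then show ?case
  proof (cases rule: less_cases)
    case diff
    from differs_below_append[OF this, of "concat ls" "[]"] show ?thesis
      by (simp add: differs_below_imp_less)
  next
    case (prefix y)
    have "concat ls \<prec> y"
      using Cons.prems prefix by (intro Cons.IH[of "u0 @ l"]) auto
    then show ?thesis using prefix by simp
  qed
qed auto

text \<open>
  If all factors of \<open>v = concat ls\<close> are strictly below \<open>u\<close>, every suffix of \<open>u\<close> dominates \<open>v\<close>,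
  and the greedy principle takes all of \<open>u\<close> first. If the first factor of \<open>v\<close> equals \<open>u\<close>, then
  \<open>v\<close> is not below \<open>u\<close> and the greedy principle takes this factor first: its suffixes,
  followed by the rest of \<open>v\<close>, are not below \<open>u\<close>. The other copy of \<open>u\<close> is then shuffled with
  the remaining factors.
\<close>

lemma shuffles_lyndon_le:
  assumes "lyndon u" "nonincreasing (u # ls)" "x \<in> shuffles u (concat ls)"
  shows "x \<preceq> u @ concat ls"
  using assms(2,3)
proof (induction ls arbitrary: x)
  case (Cons l ls)
  have suffix: "u \<preceq> u2" if "u = u1 @ u2" "u2 \<noteq> []" for u1 u2
    using that lyndon_suffix_le assms(1) by metis
  show ?case
  proof (cases "l = u")
    case True
    have "x \<in> shuffles (u @ concat ls) u"
      using Cons.prems(2) True by (simp add: shuffles_commutes)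
    moreover have "u \<preceq> u2 @ concat ls" if "u = u1 @ u2" "u2 \<noteq> []" for u1 u2
      using suffix[OF that] words.order_trans prefix_le by blast
    ultimately obtain z where "z \<in> shuffles (concat ls) u" "x \<preceq> u @ z"
      using shuffles_greedy by blast
    moreover from this(1) have "z \<preceq> u @ concat ls"
      using Cons.prems(1) by (intro Cons.IH) (auto simp: shuffles_commutes)
    ultimately show ?thesis
      using True words.order_trans by fastforce
  next
    case False
    have "l \<prec> u" using Cons.prems(1) False by (auto simp: word_le_def)
    moreover have "l' \<preceq> l" if "l' \<in> set ls" for l' using Cons.prems(1) that by simp
    ultimately have "l' \<prec> u" if "l' \<in> set (l # ls)" for l'
      using that words.le_less_trans by (metis set_ConsD)
    then have "concat (l # ls) \<prec> u2" if "u = u1 @ u2" "u2 \<noteq> []" for u1 u2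
      using lyndon_suffix_dominates[of u1 u2 "l # ls"] assms(1) that by blast
    then have "\<exists>z\<in>shuffles [] (concat (l # ls)). x \<preceq> u @ z"
      using Cons.prems(2) shuffles_greedy[of x u "[]" "concat (l # ls)"]
      by (metis append_Nil2 word_le_def)
    then show ?thesis by simp
  qed
qed auto

text \<open>
  A letter is a Lyndon word. Put it in front of a factorization and merge it with the next
  factor as long as that factor is larger.
\<close>

lemma lyndon_factorization_exists:
  "\<exists>ls. nonincreasing ls \<and> (\<forall>l\<in>set ls. lyndon l) \<and> concat ls = w"
proof (induction w)
  case Nil
  show ?case by (intro exI[of _ "[]"]) auto
next
  case (Cons a w)
  have insert: "\<exists>ms. nonincreasing ms \<and> (\<forall>l\<in>set ms. lyndon l) \<and> concat ms = u @ concat ls"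
    if "nonincreasing ls" "\<forall>l\<in>set ls. lyndon l" "lyndon u" for u ls
    using that
  proof (induction ls arbitrary: u)
    case Nil
    then show ?case by (intro exI[of _ "[u]"]) auto
  next
    case (Cons l ls)
    show ?case
    proof (cases "u \<prec> l")
      case True
      then show ?thesis using Cons.IH[of "u @ l"] Cons.prems lyndon_append by auto
    next
      case False
      then have "l \<preceq> u" by (rule words.leI)
      moreover from this have "\<forall>l'\<in>set ls. l' \<preceq> u"
        using Cons.prems(1) words.order_trans by (metis sorted_wrt.simps(2))
      ultimately show ?thesis using Cons.prems by (intro exI[of _ "u # l # ls"]) simp
    qed
  qed
  from Cons.IH obtain ls where "nonincreasing ls" "\<forall>l\<in>set ls. lyndon l" "concat ls = w" by blast
  with insert[of ls "[a]"] lyndon_singleton show ?case by auto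
qed

text \<open>
  If \<open>m\<close> were longer than \<open>l\<close>, it would overlap the remaining factors in a non-empty suffix
  \<open>y\<close> of \<open>m\<close>. This suffix dominates their concatenation, and yet it is a prefix of it.
\<close>

lemma lyndon_first_factor_length:
  assumes "nonincreasing (l # ls)" "lyndon m" "l @ concat ls = m @ w"
  shows "length m \<le> length l"
proof (rule ccontr)
  assume "\<not> length m \<le> length l"
  then obtain y where y: "m = l @ y" "y \<noteq> []" "concat ls = y @ w"
    using assms(3) by (auto simp: append_eq_append_conv2)
  have "l' \<prec> l @ y" if "l' \<in> set ls" for l'
    using assms(1) that y(2) append_less_append[of l "[]" y] words.le_less_trans by fastforce
  then have "concat ls \<prec> y"
    using lyndon_suffix_dominates[of l y ls] assms(2) y by blast
  then show False using y(3) prefix_le words.not_less by metis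
qed

lemma lyndon_factorization_unique:
  assumes "nonincreasing ls" "\<forall>l\<in>set ls. lyndon l" "nonincreasing ms" "\<forall>l\<in>set ms. lyndon l"
    and "concat ls = concat ms"
  shows "ls = ms"
  using assms
proof (induction ls arbitrary: ms)
  case Nil
  then show ?case by (cases ms) (auto simp: lyndon_def)
next
  case (Cons l ls)
  from Cons.prems obtain m ms' where ms: "ms = m # ms'"
    by (cases ms) (auto simp: lyndon_def)
  have "length l = length m"
    using lyndon_first_factor_length[of l ls m "concat ms'"]
      lyndon_first_factor_length[of m ms' l "concat ls"] Cons.prems
    unfolding ms by force
  then show ?case using Cons.IH[of ms'] Cons.prems unfolding ms by simp
qed

end


section \<open>Linear and bilinear extensions\<close>

interpretation free_module: Modules.module scale
  by (rule module_scale)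

lemma keys_scale: "Poly_Mapping.keys (scale c p) \<subseteq> Poly_Mapping.keys p"
  by (auto simp: in_keys_iff lookup_scale)

lemma lookup_lin_ext:
  "Poly_Mapping.lookup (lin_ext f p) x =
    (\<Sum>b\<in>Poly_Mapping.keys p. Poly_Mapping.lookup p b * Poly_Mapping.lookup (f b) x)"
  by (simp add: lin_ext_def lookup_sum lookup_scale)

lemma keys_lin_ext:
  "Poly_Mapping.keys (lin_ext f p) \<subseteq> (\<Union>b\<in>Poly_Mapping.keys p. Poly_Mapping.keys (f b))"
proof
  fix x assume "x \<in> Poly_Mapping.keys (lin_ext f p)"
  then have "(\<Sum>b\<in>Poly_Mapping.keys p. Poly_Mapping.lookup p b * Poly_Mapping.lookup (f b) x) \<noteq> 0"
    by (simp add: in_keys_iff lookup_lin_ext)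
  then obtain b where "b \<in> Poly_Mapping.keys p"
    "Poly_Mapping.lookup p b * Poly_Mapping.lookup (f b) x \<noteq> 0"
    by (rule sum.not_neutral_contains_not_neutral)
  then show "x \<in> (\<Union>b\<in>Poly_Mapping.keys p. Poly_Mapping.keys (f b))"
    by (intro UN_I) (auto simp: in_keys_iff)
qed

lemma lin_ext_eq_sum:
  assumes "finite F" "Poly_Mapping.keys p \<subseteq> F"
  shows "lin_ext f p = (\<Sum>b\<in>F. scale (Poly_Mapping.lookup p b) (f b))"
  unfolding lin_ext_def
  by (rule sum.mono_neutral_left) (use assms in \<open>auto simp: in_keys_iff\<close>)

lemma lin_ext_0 [simp]: "lin_ext f 0 = 0"
  by (simp add: lin_ext_def)

lemma lin_ext_single [simp]: "lin_ext f (Poly_Mapping.single b c) = scale c (f b)"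
  by (subst lin_ext_eq_sum[of "{b}"]) auto

lemma lin_ext_add: "lin_ext f (p + q) = lin_ext f p + lin_ext f q"
proof -
  let ?F = "Poly_Mapping.keys p \<union> Poly_Mapping.keys q"
  have "Poly_Mapping.keys (p + q) \<subseteq> ?F" by (rule keys_add)
  then show ?thesis
    by (subst (1 2 3) lin_ext_eq_sum[of ?F])
       (auto simp: lookup_add free_module.scale_left_distrib sum.distrib)
qed

lemma lin_ext_scale: "lin_ext f (scale c p) = scale c (lin_ext f p)"
  by (subst (1 2) lin_ext_eq_sum[of "Poly_Mapping.keys p"])
     (auto simp: lookup_scale free_module.scale_sum_right intro: keys_scale[THEN subsetD])

lemma lin_ext_uminus: "lin_ext f (- p) = - lin_ext f p"
  using lin_ext_add[of f p "- p"] by (simp add: eq_neg_iff_add_eq_0 add.commute)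

lemma lin_ext_diff: "lin_ext f (p - q) = lin_ext f p - lin_ext f q"
  using lin_ext_add[of f p "- q"] by (simp add: lin_ext_uminus)

lemma lin_ext_sum: "lin_ext f (\<Sum>i\<in>I. p i) = (\<Sum>i\<in>I. lin_ext f (p i))"
  by (induction I rule: infinite_finite_induct) (auto simp: lin_ext_add)

lemma lin_ext_cong:
  "p = q \<Longrightarrow> (\<And>b. b \<in> Poly_Mapping.keys q \<Longrightarrow> f b = g b) \<Longrightarrow> lin_ext f p = lin_ext g q"
  by (simp add: lin_ext_def)

lemma lin_ext_fun_0 [simp]: "lin_ext (\<lambda>b. 0) p = 0"
  by (simp add: lin_ext_def)

lemma lin_ext_fun_add: "lin_ext (\<lambda>b. f b + g b) p = lin_ext f p + lin_ext g p"
  by (simp add: lin_ext_def free_module.scale_right_distrib sum.distrib)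

lemma lin_ext_fun_scale: "lin_ext (\<lambda>b. scale c (f b)) p = scale c (lin_ext f p)"
  by (simp add: lin_ext_def free_module.scale_sum_right mult.commute)

lemma lin_ext_lin_ext: "lin_ext f (lin_ext g p) = lin_ext (\<lambda>b. lin_ext f (g b)) p"
  unfolding lin_ext_def[of g p] lin_ext_def[of "\<lambda>b. lin_ext f (g b)" p]
  by (simp add: lin_ext_sum lin_ext_scale)

lemma lin_ext_basis_id [simp]: "lin_ext basis p = p"
proof (rule poly_mapping_eqI)
  fix x show "Poly_Mapping.lookup (lin_ext basis p) x = Poly_Mapping.lookup p x"
    by (simp add: lookup_lin_ext lookup_single when_def if_distrib in_keys_iff cong: if_cong)
qed

lemma free_module_induct [consumes 1, case_names zero basis add scale]:
  fixes p :: "'b \<Rightarrow>\<^sub>0 'k::comm_ring_1"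
  assumes "Poly_Mapping.keys p \<subseteq> B" and zero: "P 0" and basis: "\<And>b. b \<in> B \<Longrightarrow> P (basis b)"
    and add: "\<And>p q. Poly_Mapping.keys p \<subseteq> B \<Longrightarrow> Poly_Mapping.keys q \<subseteq> B \<Longrightarrow>
      P p \<Longrightarrow> P q \<Longrightarrow> P (p + q)"
    and scale: "\<And>c p. Poly_Mapping.keys p \<subseteq> B \<Longrightarrow> P p \<Longrightarrow> P (scale c p)"
  shows "P p"
proof -
  define s where
    "s F = (\<Sum>b\<in>F. scale (Poly_Mapping.lookup p b) (basis b :: 'b \<Rightarrow>\<^sub>0 'k))" for F
  have "Poly_Mapping.keys (s F) \<subseteq> B \<and> P (s F)" if "finite F" "F \<subseteq> B" for F
    using that
  proof (induction F rule: finite_induct)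
    case empty
    then show ?case by (simp add: s_def zero)
  next
    case (insert b F)
    have "s (insert b F) = scale (Poly_Mapping.lookup p b) (basis b) + s F"
      using insert.hyps by (simp add: s_def)
    moreover have "Poly_Mapping.keys (scale (Poly_Mapping.lookup p b) (basis b :: 'b \<Rightarrow>\<^sub>0 'k)) \<subseteq> B"
      using insert.prems keys_scale[of _ "basis b :: 'b \<Rightarrow>\<^sub>0 'k"] by auto
    ultimately show ?case
      using insert keys_add[of "scale (Poly_Mapping.lookup p b) (basis b)" "s F"]
      by (auto intro!: add scale basis)
  qed
  from this[of "Poly_Mapping.keys p"] assms(1) have "P (s (Poly_Mapping.keys p))" by simp
  moreover have "s (Poly_Mapping.keys p) = p"
    unfolding s_def by (rule lin_ext_basis_id[unfolded lin_ext_def])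
  ultimately show ?thesis by simp
qed

lemmas free_module_induct_UNIV [case_names zero basis add scale] =
  free_module_induct[OF subset_UNIV]

definition bilin ::
    "('a \<Rightarrow> 'b \<Rightarrow> ('c \<Rightarrow>\<^sub>0 'k)) \<Rightarrow> ('a \<Rightarrow>\<^sub>0 'k) \<Rightarrow> ('b \<Rightarrow>\<^sub>0 'k) \<Rightarrow> ('c \<Rightarrow>\<^sub>0 'k::comm_ring_1)"
  where "bilin m p q = lin_ext (\<lambda>b. lin_ext (\<lambda>c. m b c) q) p"

lemma bilin_basis [simp]: "bilin m (basis a) (basis b) = m a b"
  by (simp add: bilin_def)

lemma bilin_basis_left: "bilin m (basis a) q = lin_ext (m a) q"
  by (simp add: bilin_def)

lemma bilin_add_left: "bilin m (p + p') q = bilin m p q + bilin m p' q"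
  by (simp add: bilin_def lin_ext_add)

lemma bilin_add_right: "bilin m p (q + q') = bilin m p q + bilin m p q'"
  by (simp add: bilin_def lin_ext_add lin_ext_fun_add)

lemma bilin_scale_left: "bilin m (scale c p) q = scale c (bilin m p q)"
  by (simp add: bilin_def lin_ext_scale)

lemma bilin_scale_right: "bilin m p (scale c q) = scale c (bilin m p q)"
  by (simp add: bilin_def lin_ext_scale lin_ext_fun_scale)

lemma bilin_0 [simp]: "bilin m 0 q = 0" "bilin m p 0 = 0"
  by (simp_all add: bilin_def)

lemmas bilin_linear = bilin_add_left bilin_add_right bilin_scale_left bilin_scale_right

lemma bilin_basis_right: "bilin m p (basis b) = lin_ext (\<lambda>a. m a b) p"
  by (simp add: bilin_def)

lemma basis_inject: "(basis a :: _ \<Rightarrow>\<^sub>0 'k::comm_ring_1) = basis b \<longleftrightarrow> a = b"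
proof
  assume "(basis a :: _ \<Rightarrow>\<^sub>0 'k) = basis b"
  then have "Poly_Mapping.keys (basis a :: _ \<Rightarrow>\<^sub>0 'k) = Poly_Mapping.keys (basis b :: _ \<Rightarrow>\<^sub>0 'k)" by simp
  then show "a = b" by simp
qed simp

lemma lin_ext_in_subspace:
  assumes "free_module.subspace K" "\<And>b. b \<in> Poly_Mapping.keys p \<Longrightarrow> f b \<in> K"
  shows "lin_ext f p \<in> K"
  unfolding lin_ext_def using assms by (auto intro!: free_module.subspace_sum free_module.subspace_scale)

lemma lin_ext_fun_diff: "lin_ext (\<lambda>b. f b - g b) p = lin_ext f p - lin_ext g p"
  by (simp add: lin_ext_def free_module.scale_right_diff_distrib sum_subtractf)

text \<open>
  A map that is linear only modulo \<open>K\<close> is determined modulo \<open>K\<close> by its values on the basis. It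
  is applied to the dependence of a pure tensor on one of its entries.
\<close>

lemma linear_mod_subspace:
  fixes f :: "('b \<Rightarrow>\<^sub>0 'k::comm_ring_1) \<Rightarrow> ('c \<Rightarrow>\<^sub>0 'k)"
  assumes K: "free_module.subspace K" and p: "Poly_Mapping.keys p \<subseteq> B"
    and add: "\<And>x y. Poly_Mapping.keys x \<subseteq> B \<Longrightarrow> Poly_Mapping.keys y \<subseteq> B \<Longrightarrow> f (x + y) - f x - f y \<in> K"
    and scale: "\<And>c x. Poly_Mapping.keys x \<subseteq> B \<Longrightarrow> f (scale c x) - scale c (f x) \<in> K"
  shows "f p - lin_ext (\<lambda>b. f (basis b)) p \<in> K"
  using p
proof (induction p rule: free_module_induct)
  case zero
  show ?case using scale[of 0 0] by simp
next
  case (basis b)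
  show ?case using K by (simp add: free_module.subspace_0)
next
  case (add p q)
  let ?l = "lin_ext (\<lambda>b. f (basis b))"
  have "f (p + q) - ?l (p + q) = (f (p + q) - f p - f q) + ((f p - ?l p) + (f q - ?l q))"
    by (simp add: lin_ext_add)
  also have "\<dots> \<in> K"
    using add assms(3)[of p q] by (intro free_module.subspace_add[OF K]) auto
  finally show ?case .
next
  case (scale c p)
  let ?l = "lin_ext (\<lambda>b. f (basis b))"
  have "f (scale c p) - ?l (scale c p) = (f (scale c p) - scale c (f p)) + scale c (f p - ?l p)"
    by (simp add: lin_ext_scale free_module.scale_right_diff_distrib)
  also have "\<dots> \<in> K"
    using scale assms(4)[of p c] by (intro free_module.subspace_add[OF K] free_module.subspace_scale[OF K]) auto
  finally show ?case .
qed

lemma bilin_lin_ext_right: "bilin m p (lin_ext f X) = lin_ext (\<lambda>w. bilin m p (f w)) X"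
  by (induction X rule: free_module_induct_UNIV) (simp_all add: lin_ext_add lin_ext_scale bilin_linear)

lemma supported_closed:
  "Poly_Mapping.keys p \<subseteq> B \<Longrightarrow> Poly_Mapping.keys q \<subseteq> B \<Longrightarrow> Poly_Mapping.keys (p + q) \<subseteq> B"
  "Poly_Mapping.keys p \<subseteq> B \<Longrightarrow> Poly_Mapping.keys q \<subseteq> B \<Longrightarrow> Poly_Mapping.keys (p - q) \<subseteq> B"
  "Poly_Mapping.keys p \<subseteq> B \<Longrightarrow> Poly_Mapping.keys (scale c p) \<subseteq> B"
  by (rule order_trans[OF keys_add] order_trans[OF keys_diff] order_trans[OF keys_scale]; simp)+

lemma subspace_supported: "free_module.subspace {p. Poly_Mapping.keys p \<subseteq> B}"
  by (rule free_module.subspaceI) (simp_all add: supported_closed)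

lemma subspace_kernel_lin_ext: "free_module.subspace {p. lin_ext f p = 0}"
  by (rule free_module.subspaceI) (simp_all add: lin_ext_add lin_ext_scale)

lemma keys_lin_ext_subset:
  assumes "Poly_Mapping.keys p \<subseteq> B" "\<And>b. b \<in> B \<Longrightarrow> Poly_Mapping.keys (f b) \<subseteq> D"
  shows "Poly_Mapping.keys (lin_ext f p) \<subseteq> D"
  using keys_lin_ext by (rule order_trans) (use assms in blast)

lemma keys_bilin_subset:
  assumes "Poly_Mapping.keys p \<subseteq> B" "Poly_Mapping.keys q \<subseteq> C"
    "\<And>b c. b \<in> B \<Longrightarrow> c \<in> C \<Longrightarrow> Poly_Mapping.keys (m b c) \<subseteq> D"
  shows "Poly_Mapping.keys (bilin m p q) \<subseteq> D"
  unfolding bilin_def using assms by (intro keys_lin_ext_subset[of _ B] keys_lin_ext_subset[of _ C])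


section \<open>The mixable shuffle product on words over a semigroup\<close>


definition prepend :: "'a \<Rightarrow> ('a list \<Rightarrow>\<^sub>0 'k) \<Rightarrow> ('a list \<Rightarrow>\<^sub>0 'k::comm_ring_1)"
  where "prepend a p = lin_ext (\<lambda>w. basis (a # w)) p"

lemma prepend_basis [simp]: "prepend a (basis w) = basis (a # w)"
  by (simp add: prepend_def)

lemma prepend_0 [simp]: "prepend a 0 = 0"
  by (simp add: prepend_def)

lemma prepend_add: "prepend a (p + q) = prepend a p + prepend a q"
  by (simp add: prepend_def lin_ext_add)

lemma prepend_scale: "prepend a (scale c p) = scale c (prepend a p)"
  by (simp add: prepend_def lin_ext_scale)

lemma keys_prepend: "Poly_Mapping.keys (prepend a p) \<subseteq> (#) a ` Poly_Mapping.keys p"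
  unfolding prepend_def using keys_lin_ext by fastforce

lemma lookup_prepend:
  "Poly_Mapping.lookup (prepend a p) (b # w) = (if b = a then Poly_Mapping.lookup p w else 0)"
  by (simp add: prepend_def lookup_lin_ext lookup_single when_def if_distrib in_keys_iff cong: if_cong)

text \<open>
  The recursion pattern of the mixable shuffle product. In contrast to shuffling, it includes
  the step from two words to both of their tails.
\<close>

lemma word_pair_induct [case_names Nil_left Nil_right Cons]:
  fixes u v :: "'a list"
  assumes "\<And>v. P [] v" "\<And>a u. P (a # u) []"
    "\<And>a u b v. P u (b # v) \<Longrightarrow> P (a # u) v \<Longrightarrow> P u v \<Longrightarrow> P (a # u) (b # v)"
  shows "P u v"
  by (rule mixable_shuffle.induct[where P = "\<lambda>_ _. P"]) (use assms in blast)+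

lemma keys_mixable_shuffle:
  assumes "\<And>a b. a \<in> C \<Longrightarrow> b \<in> C \<Longrightarrow> m a b \<in> C"
  shows "u \<in> lists C \<Longrightarrow> v \<in> lists C \<Longrightarrow> Poly_Mapping.keys (mixable_shuffle m lam u v) \<subseteq> lists C"
proof (induction u v rule: word_pair_induct)
  case (Cons a u b v)
  then have C: "a \<in> C" "b \<in> C" "u \<in> lists C" "v \<in> lists C" by auto
  have letter: "Poly_Mapping.keys (lin_ext (\<lambda>w. basis (c # w)) p :: _ \<Rightarrow>\<^sub>0 'b) \<subseteq> lists C"
    if "c \<in> C" "Poly_Mapping.keys p \<subseteq> lists C" for c p
    using that(2) by (rule keys_lin_ext_subset) (use that(1) in auto)
  show ?case unfolding mixable_shuffle.simps
    by (intro supported_closed letter C assms Cons.IH Cons.prems)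
qed simp_all

locale mixable_shuffle_algebra =
  fixes C :: "'a set" and m :: "'a \<Rightarrow> 'a \<Rightarrow> 'a" and lam :: "'k::comm_ring_1"
  assumes m_closed: "a \<in> C \<Longrightarrow> b \<in> C \<Longrightarrow> m a b \<in> C"
    and m_comm: "a \<in> C \<Longrightarrow> b \<in> C \<Longrightarrow> m a b = m b a"
    and m_assoc: "a \<in> C \<Longrightarrow> b \<in> C \<Longrightarrow> c \<in> C \<Longrightarrow> m (m a b) c = m a (m b c)"
begin

definition supported :: "('a list \<Rightarrow>\<^sub>0 'k) set"
  where "supported = {p. Poly_Mapping.keys p \<subseteq> lists C}"

abbreviation shuffle_word :: "'a list \<Rightarrow> 'a list \<Rightarrow> ('a list \<Rightarrow>\<^sub>0 'k)"
  where "shuffle_word \<equiv> mixable_shuffle m lam"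

definition shuffle_prod :: "('a list \<Rightarrow>\<^sub>0 'k) \<Rightarrow> ('a list \<Rightarrow>\<^sub>0 'k) \<Rightarrow> ('a list \<Rightarrow>\<^sub>0 'k)" (infixl \<open>\<diamondop>\<close> 70)
  where "p \<diamondop> q = bilin shuffle_word p q"

lemma shuffle_prod_linear:
  "(p + p') \<diamondop> q = p \<diamondop> q + p' \<diamondop> q" "p \<diamondop> (q + q') = p \<diamondop> q + p \<diamondop> q'"
  "scale c p \<diamondop> q = scale c (p \<diamondop> q)" "p \<diamondop> scale c q = scale c (p \<diamondop> q)"
  "0 \<diamondop> q = 0" "p \<diamondop> 0 = 0"
  by (simp_all add: shuffle_prod_def bilin_linear)

lemma shuffle_prod_basis [simp]: "basis u \<diamondop> basis v = shuffle_word u v"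
  by (simp add: shuffle_prod_def)

lemma shuffle_word_Nil_right [simp]: "shuffle_word u [] = basis u"
  by (cases u) auto

lemma shuffle_word_Cons:
  "shuffle_word (a # u) (b # v) = prepend a (shuffle_word u (b # v)) +
    prepend b (shuffle_word (a # u) v) + scale lam (prepend (m a b) (shuffle_word u v))"
  by (simp add: prepend_def)

lemma shuffle_prod_1 [simp]: "basis [] \<diamondop> p = p" "p \<diamondop> basis [] = p"
proof -
  have "shuffle_word [] = basis" by (rule ext) simp
  then show "basis [] \<diamondop> p = p" by (simp add: shuffle_prod_def bilin_basis_left)
  show "p \<diamondop> basis [] = p" by (simp add: shuffle_prod_def bilin_basis_right)
qed

text \<open>
  The recursion for words, extended bilinearly. Associativity needs it because the products
  that occur there are no longer single words.
\<close>

lemma shuffle_prod_prepend: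
  "prepend a p \<diamondop> prepend b q = prepend a (p \<diamondop> prepend b q) + prepend b (prepend a p \<diamondop> q)
    + scale lam (prepend (m a b) (p \<diamondop> q))"
proof (induction p rule: free_module_induct_UNIV)
  case (basis u)
  show ?case
  proof (induction q rule: free_module_induct_UNIV)
    case (basis v)
    show ?case by (simp only: prepend_basis shuffle_prod_basis shuffle_word_Cons)
  next
    case zero
    show ?case by (simp add: shuffle_prod_linear)
  next
    case (add p q)
    then show ?case
      by (simp only: shuffle_prod_linear prepend_add free_module.scale_right_distrib add_ac)
  next
    case (scale c p)
    then show ?case
      by (simp only: shuffle_prod_linear prepend_scale free_module.scale_right_distrib
        free_module.scale_scale mult.commute)
  qed
next
  case zero
  show ?case by (simp add: shuffle_prod_linear)
next
  case (add p q)
  then show ?case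
    by (simp only: shuffle_prod_linear prepend_add free_module.scale_right_distrib add_ac)
next
  case (scale c p)
  then show ?case
    by (simp only: shuffle_prod_linear prepend_scale free_module.scale_right_distrib
      free_module.scale_scale mult.commute)
qed

lemma supported_basis: "w \<in> lists C \<Longrightarrow> basis w \<in> supported"
  by (simp add: supported_def)

lemma supported_add: "p \<in> supported \<Longrightarrow> q \<in> supported \<Longrightarrow> p + q \<in> supported"
  by (simp add: supported_def supported_closed)

lemma supported_scale: "p \<in> supported \<Longrightarrow> scale c p \<in> supported"
  by (simp add: supported_def supported_closed)

lemma supported_shuffle_prod: "p \<in> supported \<Longrightarrow> q \<in> supported \<Longrightarrow> p \<diamondop> q \<in> supported"
  unfolding supported_def shuffle_prod_def mem_Collect_eq
  by (rule keys_bilin_subset) (use keys_mixable_shuffle[of C m, OF m_closed] in simp_all)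

lemma shuffle_word_commute:
  "u \<in> lists C \<Longrightarrow> v \<in> lists C \<Longrightarrow> shuffle_word u v = shuffle_word v u"
proof (induction u v rule: word_pair_induct)
  case (Cons a u b v)
  from Cons.prems have C: "a \<in> C" "b \<in> C" "u \<in> lists C" "v \<in> lists C" by auto
  note IH = Cons.IH(1)[OF C(3) Cons.prems(2)] Cons.IH(2)[OF Cons.prems(1) C(4)]
    Cons.IH(3)[OF C(3,4)]
  show ?case unfolding shuffle_word_Cons IH m_comm[OF C(1,2)] by (simp only: add_ac)
qed simp_all

text \<open>
  With first letters \<open>a\<close>, \<open>b\<close>, \<open>c\<close>, both sides expand into seven sums, whose words start with
  \<open>a\<close>, \<open>b\<close>, \<open>c\<close>, \<open>ab\<close>, \<open>ac\<close>, \<open>bc\<close> and \<open>abc\<close>. Corresponding sums agree by induction.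
\<close>

lemma shuffle_word_assoc:
  "u \<in> lists C \<Longrightarrow> v \<in> lists C \<Longrightarrow> w \<in> lists C \<Longrightarrow>
    shuffle_word u v \<diamondop> basis w = basis u \<diamondop> shuffle_word v w"
proof (induction "length u + length v + length w" arbitrary: u v w rule: less_induct)
  case less
  show ?case
  proof (cases "u = [] \<or> v = [] \<or> w = []")
    case True
    then show ?thesis by (elim disjE) simp_all
  next
    case False
    then obtain a u' b v' c w' where uvw: "u = a # u'" "v = b # v'" "w = c # w'"
      by (cases u; cases v; cases w) auto
    with less.prems have C: "a \<in> C" "b \<in> C" "c \<in> C"
      "u' \<in> lists C" "v' \<in> lists C" "w' \<in> lists C" by auto
    have assoc: "(basis u1 \<diamondop> basis v1) \<diamondop> basis w1 = basis u1 \<diamondop> (basis v1 \<diamondop> basis w1)"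
      if "u1 \<in> {u', u}" "v1 \<in> {v', v}" "w1 \<in> {w', w}" "u1 = u' \<or> v1 = v' \<or> w1 = w'"
      for u1 v1 w1
    proof -
      have "length u1 + length v1 + length w1 < length u + length v + length w"
        using that uvw by auto
      moreover have "u1 \<in> lists C" "v1 \<in> lists C" "w1 \<in> lists C"
        using that less.prems C by auto
      ultimately show ?thesis unfolding shuffle_prod_basis by (rule less.hyps)
    qed
    define x y z U V W where "x = (basis u :: 'a list \<Rightarrow>\<^sub>0 'k)" and "y = (basis v :: 'a list \<Rightarrow>\<^sub>0 'k)"
      and "z = (basis w :: 'a list \<Rightarrow>\<^sub>0 'k)" and "U = (basis u' :: 'a list \<Rightarrow>\<^sub>0 'k)"
      and "V = (basis v' :: 'a list \<Rightarrow>\<^sub>0 'k)" and "W = (basis w' :: 'a list \<Rightarrow>\<^sub>0 'k)"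
    note defs = x_def y_def z_def U_def V_def W_def
    have xyz: "x = prepend a U" "y = prepend b V" "z = prepend c W"
      by (simp_all add: defs uvw)
    note expand = shuffle_prod_linear prepend_add prepend_scale free_module.scale_right_distrib
      free_module.scale_scale add_ac mult_ac
    have left: "x \<diamondop> q = prepend a (U \<diamondop> q) + prepend d (x \<diamondop> q')
        + scale lam (prepend (m a d) (U \<diamondop> q'))" if "q = prepend d q'" for d q q'
      unfolding that xyz by (rule shuffle_prod_prepend)
    have right: "q \<diamondop> z = prepend d (q' \<diamondop> z) + prepend c (q \<diamondop> W)
        + scale lam (prepend (m d c) (q' \<diamondop> W))" if "q = prepend d q'" for d q q'
      unfolding that xyz by (rule shuffle_prod_prepend)
    note xy = left[OF xyz(2)] and yz = right[OF xyz(2)]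
    \<comment> \<open>The three sums starting with \<open>c\<close> on the left, and with \<open>a\<close> on the right, recombine into one.\<close>
    have "(x \<diamondop> y) \<diamondop> z = prepend a ((U \<diamondop> y) \<diamondop> z) + prepend b ((x \<diamondop> V) \<diamondop> z)
        + scale lam (prepend (m a b) ((U \<diamondop> V) \<diamondop> z)) + prepend c ((x \<diamondop> y) \<diamondop> W)
        + scale lam (prepend (m a c) ((U \<diamondop> y) \<diamondop> W)) + scale lam (prepend (m b c) ((x \<diamondop> V) \<diamondop> W))
        + scale lam (scale lam (prepend (m (m a b) c) ((U \<diamondop> V) \<diamondop> W)))"
      by (simp only: xy right[OF refl] expand)
    also have "\<dots> = prepend a (U \<diamondop> (y \<diamondop> z)) + prepend b (x \<diamondop> (V \<diamondop> z))
        + scale lam (prepend (m a b) (U \<diamondop> (V \<diamondop> z))) + prepend c (x \<diamondop> (y \<diamondop> W))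
        + scale lam (prepend (m a c) (U \<diamondop> (y \<diamondop> W))) + scale lam (prepend (m b c) (x \<diamondop> (V \<diamondop> W)))
        + scale lam (scale lam (prepend (m a (m b c)) (U \<diamondop> (V \<diamondop> W))))"
      unfolding defs by (simp only: assoc insert_iff simp_thms m_assoc[OF C(1-3)])
    also have "\<dots> = x \<diamondop> (y \<diamondop> z)"
      by (simp only: yz left[OF refl] expand)
    finally have "(x \<diamondop> y) \<diamondop> z = x \<diamondop> (y \<diamondop> z)" .
    then have "(basis u \<diamondop> basis v) \<diamondop> basis w = basis u \<diamondop> (basis v \<diamondop> basis w)"
      by (simp add: defs del: shuffle_prod_basis)
    then show ?thesis by simp
  qed
qed

lemma supported_induct [consumes 1, case_names zero basis add scale]:
  assumes "p \<in> supported" "P 0" "\<And>w. w \<in> lists C \<Longrightarrow> P (basis w)"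
    "\<And>p q. p \<in> supported \<Longrightarrow> q \<in> supported \<Longrightarrow> P p \<Longrightarrow> P q \<Longrightarrow> P (p + q)"
    "\<And>c p. p \<in> supported \<Longrightarrow> P p \<Longrightarrow> P (scale c p)"
  shows "P p"
proof -
  have "Poly_Mapping.keys p \<subseteq> lists C" using assms(1) by (simp add: supported_def)
  then show ?thesis
    by (rule free_module_induct) (use assms in \<open>simp_all add: supported_def\<close>)
qed

lemma shuffle_prod_commute:
  assumes "p \<in> supported" "q \<in> supported"
  shows "p \<diamondop> q = q \<diamondop> p"
  using assms(1)
proof (induction p rule: supported_induct)
  case (basis u)
  from assms(2) show ?case
  proof (induction q rule: supported_induct)
    case (basis v)
    with \<open>u \<in> lists C\<close> show ?case unfolding shuffle_prod_basis by (rule shuffle_word_commute)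
  qed (simp_all only: shuffle_prod_linear)
qed (simp_all only: shuffle_prod_linear)

lemma shuffle_prod_assoc:
  assumes "p \<in> supported" "q \<in> supported" "s \<in> supported"
  shows "(p \<diamondop> q) \<diamondop> s = p \<diamondop> (q \<diamondop> s)"
  using assms(1)
proof (induction p rule: supported_induct)
  case (basis u)
  from assms(2) show ?case
  proof (induction q rule: supported_induct)
    case (basis v)
    from assms(3) show ?case
    proof (induction s rule: supported_induct)
      case (basis w)
      with \<open>u \<in> lists C\<close> \<open>v \<in> lists C\<close> show ?case
        unfolding shuffle_prod_basis by (rule shuffle_word_assoc)
    qed (simp_all only: shuffle_prod_linear)
  qed (simp_all only: shuffle_prod_linear)
qed (simp_all only: shuffle_prod_linear)

definition shuffle_list :: "'a list list \<Rightarrow> ('a list \<Rightarrow>\<^sub>0 'k)"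
  where "shuffle_list us = foldr (\<lambda>u p. basis u \<diamondop> p) us (basis [])"

lemma shuffle_list_simps [simp]:
  "shuffle_list [] = basis []" "shuffle_list (u # us) = basis u \<diamondop> shuffle_list us"
  by (simp_all add: shuffle_list_def)

lemma supported_shuffle_list: "set us \<subseteq> lists C \<Longrightarrow> shuffle_list us \<in> supported"
proof (induction us)
  case (Cons u us)
  then show ?case by (simp add: supported_shuffle_prod supported_basis)
qed (simp add: supported_basis)

lemma shuffle_list_append:
  "set us \<subseteq> lists C \<Longrightarrow> set vs \<subseteq> lists C \<Longrightarrow>
    shuffle_list (us @ vs) = shuffle_list us \<diamondop> shuffle_list vs"
proof (induction us)
  case (Cons u us)
  then show ?case
    by (simp add: shuffle_prod_assoc supported_basis supported_shuffle_list)
qed simp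

lemma shuffle_list_permute:
  "mset us = mset vs \<Longrightarrow> set us \<subseteq> lists C \<Longrightarrow> shuffle_list us = shuffle_list vs"
proof (induction us arbitrary: vs)
  case (Cons u us)
  then have "u \<in> set vs" by (metis list.set_intros(1) mset_eq_setD)
  then obtain xs ys where vs: "vs = xs @ u # ys" by (auto simp: in_set_conv_decomp)
  have C: "u \<in> lists C" "set xs \<subseteq> lists C" "set ys \<subseteq> lists C" "set us \<subseteq> lists C"
    using Cons.prems(2) Cons.prems(2)[unfolded mset_eq_setD[OF Cons.prems(1)] vs] by auto
  have "mset us = mset (xs @ ys)" using Cons.prems(1) by (simp add: vs)
  from Cons.IH[OF this C(4)]
  have "shuffle_list (u # us) = basis u \<diamondop> (shuffle_list xs \<diamondop> shuffle_list ys)"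
    using C by (simp add: shuffle_list_append)
  also have "\<dots> = (basis u \<diamondop> shuffle_list xs) \<diamondop> shuffle_list ys"
    using C by (simp add: shuffle_prod_assoc supported_basis supported_shuffle_list)
  also have "\<dots> = (shuffle_list xs \<diamondop> basis u) \<diamondop> shuffle_list ys"
    using C by (simp add: shuffle_prod_commute supported_basis supported_shuffle_list)
  also have "\<dots> = shuffle_list vs"
    using C by (simp add: vs shuffle_list_append shuffle_prod_assoc supported_basis supported_shuffle_list)
  finally show ?case .
qed simp

text \<open>
  The product is commutative and associative, so the chosen enumeration of the multiset does
  not matter; see \<open>shuffle_mset_mset\<close>.
\<close>

definition shuffle_mset :: "'a list multiset \<Rightarrow> ('a list \<Rightarrow>\<^sub>0 'k)"
  where "shuffle_mset N = shuffle_list (SOME us. mset us = N)"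

lemma shuffle_mset_mset: "set us \<subseteq> lists C \<Longrightarrow> shuffle_mset (mset us) = shuffle_list us"
  unfolding shuffle_mset_def
  by (rule shuffle_list_permute[symmetric]) (metis (mono_tags) someI, assumption)

lemma shuffle_mset_single: "w \<in> lists C \<Longrightarrow> shuffle_mset {#w#} = basis w"
  using shuffle_mset_mset[of "[w]"] by simp

lemma supported_shuffle_mset:
  assumes "set_mset M \<subseteq> lists C"
  shows "shuffle_mset M \<in> supported"
proof -
  obtain us where "M = mset us" by (metis ex_mset)
  then show ?thesis using assms by (simp add: shuffle_mset_mset supported_shuffle_list)
qed

lemma shuffle_mset_add:
  assumes "set_mset M \<subseteq> lists C" "set_mset N \<subseteq> lists C"
  shows "shuffle_mset (M + N) = shuffle_mset M \<diamondop> shuffle_mset N"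
proof -
  obtain us vs where [simp]: "M = mset us" "N = mset vs" by (metis ex_mset)
  have C: "set us \<subseteq> lists C" "set vs \<subseteq> lists C" using assms by auto
  show ?thesis
    using shuffle_mset_mset[of "us @ vs"] C by (simp add: shuffle_mset_mset shuffle_list_append)
qed

text \<open>
  Multiplying two letters shortens a word, so in full length only shuffles remain.
\<close>

lemma keys_shuffle_word:
  "x \<in> Poly_Mapping.keys (shuffle_word u v) \<Longrightarrow>
    length x \<le> length u + length v \<and> (length x = length u + length v \<longrightarrow> x \<in> shuffles u v)"
proof (induction u v arbitrary: x rule: word_pair_induct)
  case (Cons a u b v)
  have "x \<in> Poly_Mapping.keys (prepend a (shuffle_word u (b # v))) \<or>
      x \<in> Poly_Mapping.keys (prepend b (shuffle_word (a # u) v)) \<or>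
      x \<in> Poly_Mapping.keys (prepend (m a b) (shuffle_word u v))"
    using Cons.prems unfolding shuffle_word_Cons
    by (auto dest!: keys_add[THEN subsetD] keys_scale[THEN subsetD] simp del: mixable_shuffle.simps)
  then consider y where "x = a # y" "y \<in> Poly_Mapping.keys (shuffle_word u (b # v))"
    | y where "x = b # y" "y \<in> Poly_Mapping.keys (shuffle_word (a # u) v)"
    | y where "x = m a b # y" "y \<in> Poly_Mapping.keys (shuffle_word u v)"
    by (auto dest!: keys_prepend[THEN subsetD])
  then show ?case
  proof cases
    case 1
    then show ?thesis using Cons.IH(1)[of y] by (auto intro: Cons_in_shuffles_leftI)
  next
    case 2
    then show ?thesis using Cons.IH(2)[of y] by (auto intro: Cons_in_shuffles_rightI)
  next
    case 3
    then show ?thesis using Cons.IH(3)[of y] by auto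
  qed
qed auto

lemma keys_shuffle_prod_basis:
  "Poly_Mapping.keys (basis u \<diamondop> p) \<subseteq> (\<Union>v\<in>Poly_Mapping.keys p. Poly_Mapping.keys (shuffle_word u v))"
  unfolding shuffle_prod_def bilin_basis_left by (rule keys_lin_ext)

end


section \<open>Triangularity of the Lyndon monomials\<close>

text \<open>
  The coefficients come from an ordered field, so that counts of shuffles are positive and
  therefore invertible.
\<close>

locale ordered_mixable_shuffle_algebra =
  mixable_shuffle_algebra C m lam + alphabet_order R
  for C :: "'a set" and m and lam :: "'k::linordered_field" and R :: "'a rel"
begin

text \<open>
  In full length the term with the weight \<open>lam\<close> does not contribute, whatever the sign of
  \<open>lam\<close>.
\<close>

lemma lookup_shuffle_word_top:
  "length x = length u + length v \<Longrightarrow> Poly_Mapping.lookup (shuffle_word u v) x \<ge> 0"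
proof (induction u v arbitrary: x rule: word_pair_induct)
  case (Cons a u b v)
  then obtain c y where x: "x = c # y" by (cases x) auto
  have "Poly_Mapping.lookup (shuffle_word u v) y = 0"
    using Cons.prems keys_shuffle_word[of y u v] x by (auto simp: in_keys_iff)
  then show ?case
    using Cons.IH(1)[of y] Cons.IH(2)[of y] Cons.prems
    unfolding shuffle_word_Cons by (simp add: x lookup_add lookup_scale lookup_prepend del: mixable_shuffle.simps)
qed (auto simp: lookup_single when_def)

lemma lookup_shuffle_word_append: "Poly_Mapping.lookup (shuffle_word u v) (u @ v) > 0"
proof (induction u v rule: word_pair_induct)
  case (Cons a u b v)
  let ?y = "u @ b # v"
  have "Poly_Mapping.lookup (shuffle_word u v) ?y = 0"
    using keys_shuffle_word[of ?y u v] by (auto simp: in_keys_iff)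
  moreover have "Poly_Mapping.lookup (shuffle_word (a # u) v) ?y \<ge> 0"
    by (rule lookup_shuffle_word_top) simp
  ultimately show ?case
    using Cons.IH(1) unfolding shuffle_word_Cons
    by (auto simp: lookup_add lookup_scale lookup_prepend simp del: mixable_shuffle.simps)
qed (auto simp: lookup_single when_def)

lemma shuffle_dominated:
  assumes "lyndon u" "nonincreasing (u # us)" "x \<in> shuffles u v" "length v = length (concat us)"
    and "v \<prec> concat us"
  shows "x \<prec> u @ concat us"
proof -
  from assms(4,5) have "v \<lless> concat us" by (simp add: less_same_length)
  from shuffles_differs_below[OF assms(3) this] obtain x'
    where "x' \<in> shuffles u (concat us)" "x \<lless> x'" by blast
  then show ?thesis
    using shuffles_lyndon_le[OF assms(1,2)] differs_below_imp_less words.less_le_trans by blast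
qed

text \<open>
  By induction, the remaining product consists of words that are shorter than \<open>concat us\<close> or,
  in full length, not above it. Those strictly below it only produce words below the target,
  and \<open>concat us\<close> itself is covered by \<open>shuffles_lyndon_le\<close>.
\<close>

lemma shuffle_list_keys:
  assumes "nonincreasing us" "\<forall>u\<in>set us. lyndon u" "x \<in> Poly_Mapping.keys (shuffle_list us)"
  shows "length x \<le> length (concat us) \<and> (length x = length (concat us) \<longrightarrow>
    mset x = mset (concat us) \<and> x \<preceq> concat us)"
  using assms
proof (induction us arbitrary: x)
  case (Cons u us)
  from Cons.prems(3) keys_shuffle_prod_basis[THEN subsetD] obtain v
    where v: "v \<in> Poly_Mapping.keys (shuffle_list us)" "x \<in> Poly_Mapping.keys (shuffle_word u v)"
    by fastforce
  note IH = Cons.IH[OF _ _ v(1)]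
  have le: "length v \<le> length (concat us)" using IH Cons.prems by simp
  note x = keys_shuffle_word[OF v(2)]
  show ?case
  proof (intro conjI impI)
    show "length x \<le> length (concat (u # us))" using x le by simp
    assume "length x = length (concat (u # us))"
    with x le have lv: "length v = length (concat us)" and xs: "x \<in> shuffles u v" by auto
    with IH Cons.prems have vv: "mset v = mset (concat us)" "v \<preceq> concat us" by auto
    show "mset x = mset (concat (u # us))" using mset_shuffles[OF xs] vv by simp
    show "x \<preceq> concat (u # us)"
    proof (cases "v = concat us")
      case True
      then show ?thesis using shuffles_lyndon_le Cons.prems xs by simp
    next
      case False
      then have "v \<prec> concat us" using vv by (simp add: word_le_def)
      then show ?thesis
        using shuffle_dominated[OF _ Cons.prems(1) xs lv] Cons.prems by (simp add: word_le_def)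
    qed
  qed
qed auto

text \<open>
  The word \<open>u @ concat us\<close> arises only from the leading word \<open>concat us\<close> of the remaining
  product, so its coefficient is a product of two positive numbers and nothing can cancel it.
\<close>

lemma shuffle_list_leading:
  assumes "nonincreasing us" "\<forall>u\<in>set us. lyndon u"
  shows "Poly_Mapping.lookup (shuffle_list us) (concat us) > 0"
  using assms
proof (induction us)
  case (Cons u us)
  let ?p = "shuffle_list us"
  have IH: "Poly_Mapping.lookup ?p (concat us) > 0" using Cons by simp
  have zero: "Poly_Mapping.lookup (shuffle_word u v) (u @ concat us) = 0"
    if v: "v \<in> Poly_Mapping.keys ?p" "v \<noteq> concat us" for v
  proof (rule ccontr)
    assume "\<not> ?thesis"
    then have "u @ concat us \<in> Poly_Mapping.keys (shuffle_word u v)" by (simp add: in_keys_iff)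
    note x = keys_shuffle_word[OF this]
    have IH: "length v \<le> length (concat us)" "length v = length (concat us) \<longrightarrow> v \<preceq> concat us"
      using shuffle_list_keys[OF _ _ v(1)] Cons.prems by simp_all
    with x have "length v = length (concat us)" by simp
    with IH v(2) have "v \<prec> concat us" by (simp add: word_le_def)
    from shuffle_dominated[OF _ Cons.prems(1) _ \<open>length v = _\<close> this] x \<open>length v = _\<close>
    show False using Cons.prems(2) by auto
  qed
  have "Poly_Mapping.lookup (shuffle_list (u # us)) (u @ concat us) =
      (\<Sum>v\<in>Poly_Mapping.keys ?p.
        Poly_Mapping.lookup ?p v * Poly_Mapping.lookup (shuffle_word u v) (u @ concat us))"
    by (simp add: shuffle_prod_def bilin_basis_left lookup_lin_ext)
  also have "\<dots> = (\<Sum>v\<in>{concat us}.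
      Poly_Mapping.lookup ?p v * Poly_Mapping.lookup (shuffle_word u v) (u @ concat us))"
    using IH zero by (intro sum.mono_neutral_right) (auto simp: in_keys_iff)
  also have "\<dots> > 0" using IH lookup_shuffle_word_append by simp
  finally show ?case by simp
qed simp

definition lyndon_words :: "'a list set"
  where "lyndon_words = {w \<in> lists C. lyndon w}"

definition lyndon_monomials :: "'a list multiset set"
  where "lyndon_monomials = {N. set_mset N \<subseteq> lyndon_words}"

text \<open>
  On polynomials in the Lyndon words this is evaluation at the Lyndon words themselves.
\<close>

definition shuffle_eval :: "('a list multiset \<Rightarrow>\<^sub>0 'k) \<Rightarrow> ('a list \<Rightarrow>\<^sub>0 'k)"
  where "shuffle_eval = lin_ext shuffle_mset"

definition decreasing_list :: "'a list multiset \<Rightarrow> 'a list list"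
  where "decreasing_list N = (SOME us. nonincreasing us \<and> mset us = N)"

lemma decreasing_list:
  "nonincreasing (decreasing_list N)" "mset (decreasing_list N) = N"
proof -
  obtain vs where vs: "mset vs = N" using ex_mset by blast
  have "nonincreasing (rev (words.sort vs))"
    by (simp add: sorted_wrt_rev words.sorted_sort)
  then have "\<exists>us. nonincreasing us \<and> mset us = N"
    using vs by (intro exI[of _ "rev (words.sort vs)"]) simp
  from someI_ex[OF this]
  show "nonincreasing (decreasing_list N)" "mset (decreasing_list N) = N"
    unfolding decreasing_list_def by blast+
qed

definition leading_word :: "'a list multiset \<Rightarrow> 'a list"
  where "leading_word N = concat (decreasing_list N)"

lemma lyndon_monomialsD:
  assumes "N \<in> lyndon_monomials"
  shows "set (decreasing_list N) \<subseteq> lists C" "\<forall>u\<in>set (decreasing_list N). lyndon u"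
    "shuffle_mset N = shuffle_list (decreasing_list N)" "set_mset N \<subseteq> lists C"
proof -
  have "set (decreasing_list N) = set_mset N" by (metis decreasing_list(2) set_mset_mset)
  then show *: "set (decreasing_list N) \<subseteq> lists C" "\<forall>u\<in>set (decreasing_list N). lyndon u"
    "set_mset N \<subseteq> lists C"
    using assms by (auto simp: lyndon_monomials_def lyndon_words_def)
  show "shuffle_mset N = shuffle_list (decreasing_list N)"
    using shuffle_mset_mset[OF *(1)] decreasing_list(2) by simp
qed

lemma leading_word_inj:
  assumes "M \<in> lyndon_monomials" "N \<in> lyndon_monomials" "leading_word M = leading_word N"
  shows "M = N"
proof -
  have "decreasing_list M = decreasing_list N"
    using assms lyndon_factorization_unique decreasing_list(1) lyndon_monomialsD(2)
    unfolding leading_word_def by blast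
  then show ?thesis by (metis decreasing_list(2))
qed

lemma shuffle_mset_leading:
  assumes "N \<in> lyndon_monomials"
  shows "Poly_Mapping.lookup (shuffle_mset N) (leading_word N) > 0"
  using shuffle_list_leading[OF decreasing_list(1)] lyndon_monomialsD[OF assms]
  by (simp add: leading_word_def)

lemma shuffle_mset_keys:
  assumes "N \<in> lyndon_monomials" "x \<in> Poly_Mapping.keys (shuffle_mset N)"
  shows "length x \<le> length (leading_word N)"
    "length x = length (leading_word N) \<Longrightarrow> mset x = mset (leading_word N) \<and> x \<preceq> leading_word N"
  using shuffle_list_keys[OF decreasing_list(1)] lyndon_monomialsD[OF assms(1)] assms(2)
  by (simp_all add: leading_word_def)

text \<open>
  Distinct monomials have distinct leading words. The largest leading word in \<open>p\<close> therefore
  occurs in the image of one monomial only and survives.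
\<close>

lemma shuffle_eval_eq_0:
  assumes "Poly_Mapping.keys p \<subseteq> lyndon_monomials" "shuffle_eval p = 0"
  shows "p = 0"
proof (rule ccontr)
  assume "p \<noteq> 0"
  let ?K = "Poly_Mapping.keys p"
  define l where "l = Max (length ` leading_word ` ?K)"
  have K: "finite ?K" "?K \<noteq> {}" using \<open>p \<noteq> 0\<close> by auto
  then have l: "l \<in> length ` leading_word ` ?K" unfolding l_def by (intro Max_in) auto
  have le_l: "length (leading_word M) \<le> l" if "M \<in> ?K" for M
    unfolding l_def using K that by (intro Max_ge) auto
  \<comment> \<open>Among the leading words of maximal length, the lexicographically largest one will survive.\<close>
  define A where "A = leading_word ` {N \<in> ?K. length (leading_word N) = l}"
  have A: "finite A" "A \<noteq> {}" using K l by (auto simp: A_def)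
  then have "words.Max A \<in> A" by (rule words.Max_in)
  then obtain N where N: "N \<in> ?K" "length (leading_word N) = l" "leading_word N = words.Max A"
    by (auto simp: A_def)
  have le: "leading_word M \<preceq> leading_word N" if "M \<in> ?K" "length (leading_word M) = l" for M
    unfolding N(3) using A that by (intro words.Max_ge) (auto simp: A_def)
  have zero: "Poly_Mapping.lookup (shuffle_mset M) (leading_word N) = 0" if M: "M \<in> ?K" "M \<noteq> N" for M
  proof (rule ccontr)
    assume "\<not> ?thesis"
    then have key: "leading_word N \<in> Poly_Mapping.keys (shuffle_mset M)" by (simp add: in_keys_iff)
    have "M \<in> lyndon_monomials" using M assms(1) by blast
    note * = shuffle_mset_keys[OF this key]
    have "length (leading_word M) = l" using *(1) le_l[OF M(1)] N(2) by simp
    moreover from this have "leading_word N \<preceq> leading_word M" using *(2) N(2) by simp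
    ultimately have "leading_word M = leading_word N" using le[OF M(1)] words.order_antisym by blast
    then show False using leading_word_inj M N(1) assms(1) by blast
  qed
  have "Poly_Mapping.lookup (shuffle_eval p) (leading_word N) =
      (\<Sum>M\<in>?K. Poly_Mapping.lookup p M * Poly_Mapping.lookup (shuffle_mset M) (leading_word N))"
    by (simp add: shuffle_eval_def lookup_lin_ext)
  also have "\<dots> = (\<Sum>M\<in>{N}. Poly_Mapping.lookup p M * Poly_Mapping.lookup (shuffle_mset M) (leading_word N))"
    using N zero K by (intro sum.mono_neutral_right) auto
  also have "\<dots> \<noteq> 0"
    using N(1) shuffle_mset_leading[of N] assms(1) by (auto simp: in_keys_iff)
  finally show False using assms(2) by simp
qed

lemma finite_same_letters: "finite {x. mset x = M}"
proof (rule finite_subset)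
  show "{x. mset x = M} \<subseteq> {x. set x \<subseteq> set_mset M \<and> length x = size M}" by auto
  show "finite {x. set x \<subseteq> set_mset M \<and> length x = size M}" by (rule finite_lists_length_eq) simp
qed

lemma shuffle_eval_add: "shuffle_eval (p + q) = shuffle_eval p + shuffle_eval q"
  by (simp add: shuffle_eval_def lin_ext_add)

lemma shuffle_eval_scale: "shuffle_eval (scale c p) = scale c (shuffle_eval p)"
  by (simp add: shuffle_eval_def lin_ext_scale)

lemma shuffle_eval_basis [simp]: "shuffle_eval (basis N) = shuffle_mset N"
  by (simp add: shuffle_eval_def)

definition lyndon_span :: "('a list \<Rightarrow>\<^sub>0 'k) set"
  where "lyndon_span = shuffle_eval ` {p. Poly_Mapping.keys p \<subseteq> lyndon_monomials}"

lemma lyndon_spanI: "Poly_Mapping.keys p \<subseteq> lyndon_monomials \<Longrightarrow> shuffle_eval p \<in> lyndon_span"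
  by (simp add: lyndon_span_def)

lemma lyndon_spanE:
  assumes "p \<in> lyndon_span"
  obtains q where "Poly_Mapping.keys q \<subseteq> lyndon_monomials" "p = shuffle_eval q"
  using assms by (auto simp: lyndon_span_def)

lemma lyndon_span_add:
  assumes "p \<in> lyndon_span" "q \<in> lyndon_span"
  shows "p + q \<in> lyndon_span"
proof -
  obtain p' where p': "Poly_Mapping.keys p' \<subseteq> lyndon_monomials" "p = shuffle_eval p'"
    using assms(1) by (rule lyndon_spanE)
  obtain q' where q': "Poly_Mapping.keys q' \<subseteq> lyndon_monomials" "q = shuffle_eval q'"
    using assms(2) by (rule lyndon_spanE)
  have "Poly_Mapping.keys (p' + q') \<subseteq> lyndon_monomials"
    by (rule order_trans[OF keys_add]) (use p' q' in simp)
  then show ?thesis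
    unfolding p'(2) q'(2) shuffle_eval_add[symmetric] by (rule lyndon_spanI)
qed

lemma lyndon_span_scale:
  assumes "p \<in> lyndon_span"
  shows "scale c p \<in> lyndon_span"
proof -
  obtain p' where p': "Poly_Mapping.keys p' \<subseteq> lyndon_monomials" "p = shuffle_eval p'"
    using assms by (rule lyndon_spanE)
  have "Poly_Mapping.keys (scale c p') \<subseteq> lyndon_monomials"
    by (rule order_trans[OF keys_scale p'(1)])
  then show ?thesis
    unfolding p'(2) shuffle_eval_scale[symmetric] by (rule lyndon_spanI)
qed

lemma lyndon_span_0: "0 \<in> lyndon_span"
  unfolding lyndon_span_def by (rule image_eqI[of _ _ 0]) (auto simp: shuffle_eval_def)

lemma lyndon_span_supported:
  assumes "Poly_Mapping.keys p \<subseteq> B" "\<And>w. w \<in> B \<Longrightarrow> basis w \<in> lyndon_span"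
  shows "p \<in> lyndon_span"
  using assms(1)
  by (rule free_module_induct) (use assms(2) lyndon_span_0 lyndon_span_add lyndon_span_scale in auto)

text \<open>
  Solving the triangular system. The words below \<open>w\<close> that can occur are either shorter or
  rearrangements of \<open>w\<close>, of which there are finitely many; the recursion is on the length and
  then on the number of smaller rearrangements.
\<close>

lemma basis_in_lyndon_span: "w \<in> lists C \<Longrightarrow> basis w \<in> lyndon_span"
proof (induction w rule: wf_induct_rule[OF
    wf_measures[of "[length, \<lambda>w. card {y. mset y = mset w \<and> y \<prec> w}]"]])
  case (1 w)
  obtain us where us: "nonincreasing us" "\<forall>u\<in>set us. lyndon u" "concat us = w"
    using lyndon_factorization_exists by blast
  have C: "set us \<subseteq> lists C" using 1(2) us(3) by fastforce
  let ?p = "shuffle_list us" and ?c = "Poly_Mapping.lookup (shuffle_list us) w"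
  define rest where "rest = ?p - scale ?c (basis w)"
  have "?c > 0" using shuffle_list_leading[OF us(1,2)] us(3) by simp
  have "mset us \<in> lyndon_monomials"
    using us(2) C by (auto simp: lyndon_monomials_def lyndon_words_def)
  then have p: "?p \<in> lyndon_span"
    unfolding lyndon_span_def using shuffle_mset_mset[OF C]
    by (intro image_eqI[of _ _ "basis (mset us)"]) auto
  have keys_rest: "Poly_Mapping.keys rest \<subseteq> Poly_Mapping.keys ?p - {w}"
    by (auto simp: rest_def in_keys_iff lookup_minus lookup_scale lookup_single when_def split: if_splits)
  have "rest \<in> lyndon_span"
  proof (rule lyndon_span_supported[OF keys_rest])
    fix x assume x: "x \<in> Poly_Mapping.keys ?p - {w}"
    then have le: "length x \<le> length w" "length x = length w \<longrightarrow> mset x = mset w \<and> x \<preceq> w"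
      using shuffle_list_keys[OF us(1,2)] us(3) by auto
    have "card {y. mset y = mset x \<and> y \<prec> x} < card {y. mset y = mset w \<and> y \<prec> w}"
      if "mset x = mset w" "x \<prec> w"
    proof (rule psubset_card_mono)
      show "finite {y. mset y = mset w \<and> y \<prec> w}"
        using finite_same_letters by (rule rev_finite_subset) auto
      show "{y. mset y = mset x \<and> y \<prec> x} \<subset> {y. mset y = mset w \<and> y \<prec> w}"
        using that words.less_trans by auto
    qed
    then have "(x, w) \<in> measures [length, \<lambda>w. card {y. mset y = mset w \<and> y \<prec> w}]"
      using x le by (auto simp: word_le_def)
    moreover have "x \<in> lists C"
      using supported_shuffle_list[OF C] x by (auto simp: supported_def)
    ultimately show "basis x \<in> lyndon_span" by (rule 1(1))
  qed
  then have "scale (1 / ?c) (?p + scale (- 1) rest) \<in> lyndon_span"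
    by (intro lyndon_span_scale lyndon_span_add p)
  also have "?p + scale (- 1) rest = scale ?c (basis w)"
    by (simp add: rest_def)
  finally show ?case using \<open>?c > 0\<close> by simp
qed

lemma shuffle_eval_surj: "shuffle_eval ` {p. Poly_Mapping.keys p \<subseteq> lyndon_monomials} = supported"
proof
  show "shuffle_eval ` {p. Poly_Mapping.keys p \<subseteq> lyndon_monomials} \<subseteq> supported"
  proof safe
    fix p :: "'a list multiset \<Rightarrow>\<^sub>0 'k" assume "Poly_Mapping.keys p \<subseteq> lyndon_monomials"
    then show "shuffle_eval p \<in> supported"
    proof (induction p rule: free_module_induct)
      case zero
      then show ?case by (simp add: shuffle_eval_def supported_def)
    next
      case (basis N)
      then show ?case using supported_shuffle_mset lyndon_monomialsD(4) by simp
    qed (simp_all add: shuffle_eval_add shuffle_eval_scale supported_add supported_scale)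
  qed
  show "supported \<subseteq> shuffle_eval ` {p. Poly_Mapping.keys p \<subseteq> lyndon_monomials}"
    unfolding lyndon_span_def[symmetric]
  proof
    fix p assume "p \<in> supported"
    then have "Poly_Mapping.keys p \<subseteq> lists C" by (simp add: supported_def)
    then show "p \<in> lyndon_span" by (rule lyndon_span_supported) (rule basis_in_lyndon_span)
  qed
qed

lemma shuffle_eval_inj: "inj_on shuffle_eval {p. Poly_Mapping.keys p \<subseteq> lyndon_monomials}"
proof (rule inj_onI)
  fix p q :: "'a list multiset \<Rightarrow>\<^sub>0 'k" assume pq: "p \<in> {p. Poly_Mapping.keys p \<subseteq> lyndon_monomials}"
    "q \<in> {p. Poly_Mapping.keys p \<subseteq> lyndon_monomials}" and eq: "shuffle_eval p = shuffle_eval q"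
  have "Poly_Mapping.keys (p - q) \<subseteq> lyndon_monomials"
    using pq keys_diff[of p q] by auto
  moreover have "shuffle_eval (p - q) = 0"
    using eq by (simp add: shuffle_eval_def lin_ext_diff)
  ultimately show "p = q" using shuffle_eval_eq_0 by fastforce
qed

lemma shuffle_eval_mult:
  assumes "Poly_Mapping.keys p \<subseteq> lyndon_monomials" "Poly_Mapping.keys q \<subseteq> lyndon_monomials"
  shows "shuffle_eval (bilin (\<lambda>M N. basis (M + N)) p q) = shuffle_eval p \<diamondop> shuffle_eval q"
  using assms(1)
proof (induction p rule: free_module_induct)
  case (basis M)
  from assms(2) show ?case
  proof (induction q rule: free_module_induct)
    case (basis N)
    then show ?case using \<open>M \<in> _\<close> by (simp add: shuffle_mset_add lyndon_monomialsD(4))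
  next
    case zero
    show ?case by (simp add: shuffle_eval_def shuffle_prod_linear)
  qed (simp_all only: shuffle_eval_add shuffle_eval_scale bilin_linear shuffle_prod_linear)
next
  case zero
  show ?case by (simp add: shuffle_eval_def shuffle_prod_linear)
qed (simp_all only: shuffle_eval_add shuffle_eval_scale bilin_linear shuffle_prod_linear)

end


section \<open>Isomorphisms of algebras\<close>

text \<open>
  The closure conditions under which isomorphisms can be inverted and quotients formed. The
  records do not carry them.
\<close>

definition alg_closed :: "('k, 'a) module \<Rightarrow> bool"
  where "alg_closed A \<longleftrightarrow> \<one>\<^bsub>A\<^esub> \<in> carrier A \<and>
    (\<forall>x\<in>carrier A. \<forall>y\<in>carrier A. x \<otimes>\<^bsub>A\<^esub> y \<in> carrier A \<and> x \<oplus>\<^bsub>A\<^esub> y \<in> carrier A) \<and>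
    (\<forall>c. \<forall>x\<in>carrier A. c \<odot>\<^bsub>A\<^esub> x \<in> carrier A)"

lemma alg_isoI:
  assumes "bij_betw f (carrier A) (carrier B)" "f \<one>\<^bsub>A\<^esub> = \<one>\<^bsub>B\<^esub>"
    and "\<And>x y. x \<in> carrier A \<Longrightarrow> y \<in> carrier A \<Longrightarrow> f (x \<otimes>\<^bsub>A\<^esub> y) = f x \<otimes>\<^bsub>B\<^esub> f y"
    and "\<And>x y. x \<in> carrier A \<Longrightarrow> y \<in> carrier A \<Longrightarrow> f (x \<oplus>\<^bsub>A\<^esub> y) = f x \<oplus>\<^bsub>B\<^esub> f y"
    and "\<And>c x. x \<in> carrier A \<Longrightarrow> f (c \<odot>\<^bsub>A\<^esub> x) = c \<odot>\<^bsub>B\<^esub> f x"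
  shows "f \<in> alg_iso A B"
  using assms bij_betwE[OF assms(1)] by (auto simp: alg_iso_def ring_iso_def ring_hom_def)

lemma alg_isoD:
  assumes "f \<in> alg_iso A B"
  shows "bij_betw f (carrier A) (carrier B)" "f \<one>\<^bsub>A\<^esub> = \<one>\<^bsub>B\<^esub>"
    and "\<And>x y. x \<in> carrier A \<Longrightarrow> y \<in> carrier A \<Longrightarrow> f (x \<otimes>\<^bsub>A\<^esub> y) = f x \<otimes>\<^bsub>B\<^esub> f y"
    and "\<And>x y. x \<in> carrier A \<Longrightarrow> y \<in> carrier A \<Longrightarrow> f (x \<oplus>\<^bsub>A\<^esub> y) = f x \<oplus>\<^bsub>B\<^esub> f y"
    and "\<And>c x. x \<in> carrier A \<Longrightarrow> f (c \<odot>\<^bsub>A\<^esub> x) = c \<odot>\<^bsub>B\<^esub> f x"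
    and "\<And>x. x \<in> carrier A \<Longrightarrow> f x \<in> carrier B"
  using assms by (auto simp: alg_iso_def ring_iso_def ring_hom_def)

lemma alg_iso_compose:
  assumes "f \<in> alg_iso A B" "g \<in> alg_iso B C"
  shows "g \<circ> f \<in> alg_iso A C"
  by (rule alg_isoI)
    (use alg_isoD[OF assms(1)] alg_isoD[OF assms(2)] in \<open>auto intro: bij_betw_trans\<close>)

lemma alg_iso_inv:
  assumes A: "alg_closed A" and f: "f \<in> alg_iso A B"
  shows "inv_into (carrier A) f \<in> alg_iso B A"
proof -
  let ?g = "inv_into (carrier A) f"
  note f = alg_isoD[OF f]
  have g: "?g (f x) = x" if "x \<in> carrier A" for x
    using f(1) that by (simp add: bij_betw_def)
  have B: "\<exists>x\<in>carrier A. y = f x" if "y \<in> carrier B" for y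
    using f(1) that by (auto simp: bij_betw_def)
  show ?thesis
  proof (rule alg_isoI)
    show "bij_betw ?g (carrier B) (carrier A)" using f(1) by (rule bij_betw_inv_into)
    show "?g \<one>\<^bsub>B\<^esub> = \<one>\<^bsub>A\<^esub>" using g A f(2) by (metis alg_closed_def)
    fix x y c assume x: "x \<in> carrier B"
    from B[OF x] obtain x' where x': "x' \<in> carrier A" "x = f x'" by blast
    then show "?g (c \<odot>\<^bsub>B\<^esub> x) = c \<odot>\<^bsub>A\<^esub> ?g x"
      using g[of "c \<odot>\<^bsub>A\<^esub> x'"] g[of x'] f(5)[of x' c] A by (simp add: alg_closed_def)
    assume "y \<in> carrier B"
    from B[OF this] obtain y' where y': "y' \<in> carrier A" "y = f y'" by blast
    show "?g (x \<otimes>\<^bsub>B\<^esub> y) = ?g x \<otimes>\<^bsub>A\<^esub> ?g y"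
      using g[of "x' \<otimes>\<^bsub>A\<^esub> y'"] g[of x'] g[of y'] f(3)[of x' y'] A x' y' by (simp add: alg_closed_def)
    show "?g (x \<oplus>\<^bsub>B\<^esub> y) = ?g x \<oplus>\<^bsub>A\<^esub> ?g y"
      using g[of "x' \<oplus>\<^bsub>A\<^esub> y'"] g[of x'] g[of y'] f(4)[of x' y'] A x' y' by (simp add: alg_closed_def)
  qed
qed

lemma basis_alg_simps [simp]:
  "carrier (basis_alg B m e) = {p. Poly_Mapping.keys p \<subseteq> B}"
  "p \<otimes>\<^bsub>basis_alg B m e\<^esub> q = bilin m p q"
  "p \<oplus>\<^bsub>basis_alg B m e\<^esub> q = p + q"
  "\<one>\<^bsub>basis_alg B m e\<^esub> = basis e"
  "\<zero>\<^bsub>basis_alg B m e\<^esub> = 0"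
  "c \<odot>\<^bsub>basis_alg B m e\<^esub> p = scale c p"
  by (simp_all add: basis_alg_def bilin_def)

lemma alg_closed_basis_alg:
  assumes "e \<in> B" "\<And>b c. b \<in> B \<Longrightarrow> c \<in> B \<Longrightarrow> Poly_Mapping.keys (m b c) \<subseteq> B"
  shows "alg_closed (basis_alg B m e)"
  using assms by (simp add: alg_closed_def supported_closed keys_bilin_subset[of _ B _ B])

text \<open>
  The cosets of \<open>K\<close> in \<open>P\<close> are the fibres of \<open>h\<close>, and a coset operation amounts to the
  operation of \<open>T\<close> on the common value of \<open>h\<close>.
\<close>

lemma quotient_basis_alg:
  fixes m :: "'b \<Rightarrow> 'b \<Rightarrow> ('b \<Rightarrow>\<^sub>0 'k::comm_ring_1)" and T :: "('k, 'c) module"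
    and B :: "'b set" and e :: 'b
  assumes P_def: "P = basis_alg B m e" and P: "alg_closed P" and K: "K \<subseteq> carrier P"
    and onto: "h ` carrier P = carrier T"
    and kernel: "\<And>p q. p \<in> carrier P \<Longrightarrow> q \<in> carrier P \<Longrightarrow> h p = h q \<longleftrightarrow> p - q \<in> K"
    and one: "h \<one>\<^bsub>P\<^esub> = \<one>\<^bsub>T\<^esub>"
    and mult: "\<And>p q. p \<in> carrier P \<Longrightarrow> q \<in> carrier P \<Longrightarrow> h (p \<otimes>\<^bsub>P\<^esub> q) = h p \<otimes>\<^bsub>T\<^esub> h q"
    and add: "\<And>p q. p \<in> carrier P \<Longrightarrow> q \<in> carrier P \<Longrightarrow> h (p + q) = h p \<oplus>\<^bsub>T\<^esub> h q"
    and smult: "\<And>c p. p \<in> carrier P \<Longrightarrow> h (scale c p) = c \<odot>\<^bsub>T\<^esub> h p"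
  shows "alg_closed (quotient_alg P K)"
    and "\<exists>F\<in>alg_iso (quotient_alg P K) T. \<forall>p\<in>carrier P. F (K +>\<^bsub>P\<^esub> p) = h p"
proof -
  let ?Q = "quotient_alg P K"
  define fib where "fib p = {x \<in> carrier P. h x = h p}" for p
  have coset: "K +>\<^bsub>P\<^esub> p = fib p" if p: "p \<in> carrier P" for p
  proof -
    have "K +>\<^bsub>P\<^esub> p = {k + p | k. k \<in> K}"
      by (auto simp: a_r_coset_def r_coset_def P_def)
    also have "\<dots> = fib p"
    proof safe
      fix k assume k: "k \<in> K"
      then have "k + p \<in> carrier P" using K p by (auto simp: P_def intro: supported_closed(1)[THEN subsetD])
      then show "k + p \<in> fib p" using kernel[of "k + p" p] k p by (simp add: fib_def)
    next
      fix x assume "x \<in> fib p"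
      then have "x - p \<in> K" using kernel[of x p] p by (simp add: fib_def)
      then show "\<exists>k. x = k + p \<and> k \<in> K" by (intro exI[of _ "x - p"]) simp
    qed
    finally show ?thesis .
  qed
  have fib_eq: "fib x = fib p" if "x \<in> fib p" for x p using that by (auto simp: fib_def)
  have self: "p \<in> fib p" if "p \<in> carrier P" for p using that by (simp add: fib_def)
  have sub: "fib p \<subseteq> carrier P" for p by (auto simp: fib_def)
  have closed: "\<one>\<^bsub>P\<^esub> \<in> carrier P"
    "\<And>p q. p \<in> carrier P \<Longrightarrow> q \<in> carrier P \<Longrightarrow> p \<otimes>\<^bsub>P\<^esub> q \<in> carrier P \<and> p + q \<in> carrier P"
    "\<And>p q. p \<in> carrier P \<Longrightarrow> q \<in> carrier P \<Longrightarrow> p - q \<in> carrier P"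
    "\<And>c p. p \<in> carrier P \<Longrightarrow> scale c p \<in> carrier P"
    using P by (simp_all add: alg_closed_def P_def supported_closed)
  have carrier_Q: "carrier ?Q = fib ` carrier P"
    using coset by (auto simp: quotient_alg_def ring.defs FactRing_def A_RCOSETS_def RCOSETS_def
        a_r_coset_def[symmetric])
  have one_Q: "\<one>\<^bsub>?Q\<^esub> = fib \<one>\<^bsub>P\<^esub>"
    using coset[OF closed(1)] by (simp add: quotient_alg_def ring.defs FactRing_def)
  have mult_Q: "fib p \<otimes>\<^bsub>?Q\<^esub> fib q = fib (p \<otimes>\<^bsub>P\<^esub> q)" if pq: "p \<in> carrier P" "q \<in> carrier P" for p q
  proof -
    have "K +>\<^bsub>P\<^esub> (x \<otimes>\<^bsub>P\<^esub> y) = fib (p \<otimes>\<^bsub>P\<^esub> q)" if "x \<in> fib p" "y \<in> fib q" for x y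
      using that mult closed(2) pq sub by (subst coset) (auto simp: fib_def)
    then have "(\<Union>x\<in>fib p. \<Union>y\<in>fib q. K +>\<^bsub>P\<^esub> (x \<otimes>\<^bsub>P\<^esub> y)) = fib (p \<otimes>\<^bsub>P\<^esub> q)"
      using self[OF pq(1)] self[OF pq(2)] by blast
    then show ?thesis
      by (simp add: quotient_alg_def ring.defs FactRing_def rcoset_mult_def)
  qed
  have add_Q: "fib p \<oplus>\<^bsub>?Q\<^esub> fib q = fib (p + q)" if pq: "p \<in> carrier P" "q \<in> carrier P" for p q
  proof -
    have "fib p \<oplus>\<^bsub>?Q\<^esub> fib q = {x + y | x y. x \<in> fib p \<and> y \<in> fib q}"
      by (auto simp: quotient_alg_def ring.defs FactRing_def set_add_def set_mult_def P_def)
    also have "\<dots> = fib (p + q)"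
    proof safe
      fix x y assume "x \<in> fib p" "y \<in> fib q"
      then show "x + y \<in> fib (p + q)" using add closed(2) pq by (auto simp: fib_def)
    next
      fix z assume z: "z \<in> fib (p + q)"
      then have zc: "z \<in> carrier P" using sub by blast
      have "z - (p + q) \<in> K" using kernel[of z "p + q"] z zc closed(2) pq by (simp add: fib_def)
      then have "h (z - p) = h q"
        using kernel[of "z - p" q] closed(3) zc pq by (simp add: algebra_simps)
      then show "\<exists>x y. z = x + y \<and> x \<in> fib p \<and> y \<in> fib q"
        using self[OF pq(1)] closed(3)[OF zc pq(1)] by (intro exI[of _ p] exI[of _ "z - p"]) (simp add: fib_def)
    qed
    finally show ?thesis .
  qed
  have smult_Q: "c \<odot>\<^bsub>?Q\<^esub> fib p = fib (scale c p)" if p: "p \<in> carrier P" for c p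
  proof -
    have "K +>\<^bsub>P\<^esub> (c \<odot>\<^bsub>P\<^esub> x) = fib (scale c p)" if "x \<in> fib p" for x
      using that smult closed(4) p sub by (subst coset) (auto simp: fib_def P_def)
    then have "(\<Union>x\<in>fib p. K +>\<^bsub>P\<^esub> (c \<odot>\<^bsub>P\<^esub> x)) = fib (scale c p)"
      using self[OF p] by blast
    then show ?thesis by (simp add: quotient_alg_def ring.defs)
  qed
  show "alg_closed ?Q"
    unfolding alg_closed_def carrier_Q one_Q
    using mult_Q add_Q smult_Q closed by auto
  define F where "F U = h (SOME x. x \<in> U)" for U
  have F: "F (fib p) = h p" if "p \<in> carrier P" for p
  proof -
    have "(SOME x. x \<in> fib p) \<in> fib p" using self[OF that] by (rule someI)
    then show ?thesis by (simp add: F_def fib_def)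
  qed
  have "F \<in> alg_iso ?Q T"
  proof (rule alg_isoI)
    show "bij_betw F (carrier ?Q) (carrier T)"
      unfolding bij_betw_def
    proof
      show "inj_on F (carrier ?Q)" unfolding carrier_Q
        by (rule inj_onI) (auto simp: F, auto simp: fib_def)
      show "F ` carrier ?Q = carrier T"
        unfolding carrier_Q onto[symmetric] image_image using F by (intro image_cong) auto
    qed
  qed (use F closed one mult add smult in \<open>auto simp: carrier_Q one_Q mult_Q add_Q smult_Q\<close>)
  then show "\<exists>F\<in>alg_iso ?Q T. \<forall>p\<in>carrier P. F (K +>\<^bsub>P\<^esub> p) = h p"
    using F coset by auto
qed

lemma coset_in_quotient_alg: "p \<in> carrier P \<Longrightarrow> K +>\<^bsub>P\<^esub> p \<in> carrier (quotient_alg P K)"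
  by (auto simp: quotient_alg_def ring.defs FactRing_def A_RCOSETS_def RCOSETS_def a_r_coset_def)

lemma monoid_alg_simps [simp]:
  "carrier (monoid_alg S) = {p. Poly_Mapping.keys p \<subseteq> carrier S}"
  "p \<otimes>\<^bsub>monoid_alg S\<^esub> q = bilin (\<lambda>s t. basis (s \<otimes>\<^bsub>S\<^esub> t)) p q"
  "p \<oplus>\<^bsub>monoid_alg S\<^esub> q = p + q"
  "\<one>\<^bsub>monoid_alg S\<^esub> = basis \<one>\<^bsub>S\<^esub>"
  "c \<odot>\<^bsub>monoid_alg S\<^esub> p = scale c p"
  by (simp_all add: monoid_alg_def)

lemma alg_closed_monoid_alg: "Group.monoid S \<Longrightarrow> alg_closed (monoid_alg S)"
  unfolding monoid_alg_def
  by (rule alg_closed_basis_alg) (auto simp: Group.monoid.m_closed Group.monoid.one_closed)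

lemma monoid_alg_iso:
  fixes S :: "('s, 'm) monoid_scheme" and T :: "('t, 'n) monoid_scheme"
  assumes bij: "bij_betw \<mu> (carrier S) (carrier T)" and one: "\<mu> \<one>\<^bsub>S\<^esub> = \<one>\<^bsub>T\<^esub>"
    and mult: "\<And>s t. s \<in> carrier S \<Longrightarrow> t \<in> carrier S \<Longrightarrow> \<mu> (s \<otimes>\<^bsub>S\<^esub> t) = \<mu> s \<otimes>\<^bsub>T\<^esub> \<mu> t"
  shows "lin_ext (\<lambda>s. basis (\<mu> s)) \<in>
    alg_iso (monoid_alg S) (monoid_alg T :: ('k::comm_ring_1, 't \<Rightarrow>\<^sub>0 'k) module)"
proof (rule alg_isoI)
  let ?f = "lin_ext (\<lambda>s. basis (\<mu> s)) :: ('s \<Rightarrow>\<^sub>0 'k) \<Rightarrow> ('t \<Rightarrow>\<^sub>0 'k)"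
    and ?g = "lin_ext (\<lambda>t. basis (inv_into (carrier S) \<mu> t)) :: ('t \<Rightarrow>\<^sub>0 'k) \<Rightarrow> ('s \<Rightarrow>\<^sub>0 'k)"
  show "bij_betw ?f (carrier (monoid_alg S)) (carrier (monoid_alg T))"
  proof (rule bij_betw_byWitness[where f' = ?g])
    show "\<forall>p\<in>carrier (monoid_alg S). ?g (?f p) = p"
    proof
      fix p :: "'s \<Rightarrow>\<^sub>0 'k" assume "p \<in> carrier (monoid_alg S)"
      then have "?g (?f p) = lin_ext basis p"
        unfolding lin_ext_lin_ext using bij by (intro lin_ext_cong) (auto simp: bij_betw_def subset_eq)
      then show "?g (?f p) = p" by simp
    qed
    show "\<forall>p\<in>carrier (monoid_alg T). ?f (?g p) = p"
    proof
      fix p :: "'t \<Rightarrow>\<^sub>0 'k" assume "p \<in> carrier (monoid_alg T)"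
      then have "?f (?g p) = lin_ext basis p"
        unfolding lin_ext_lin_ext using bij
        by (intro lin_ext_cong) (auto simp: bij_betw_def subset_eq f_inv_into_f)
      then show "?f (?g p) = p" by simp
    qed
    show "?f ` carrier (monoid_alg S) \<subseteq> carrier (monoid_alg T)"
      using bij_betwE[OF bij] by (intro image_subsetI) (simp add: keys_lin_ext_subset[of _ "carrier S"])
    show "?g ` carrier (monoid_alg T) \<subseteq> carrier (monoid_alg S)"
      using bij_betwE[OF bij_betw_inv_into[OF bij]]
      by (intro image_subsetI) (simp add: keys_lin_ext_subset[of _ "carrier T"])
  qed
  fix p q :: "'s \<Rightarrow>\<^sub>0 'k"
  assume "p \<in> carrier (monoid_alg S)" "q \<in> carrier (monoid_alg S)"
  then have p: "Poly_Mapping.keys p \<subseteq> carrier S" and q: "Poly_Mapping.keys q \<subseteq> carrier S" by simp_all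
  from p have "?f (bilin (\<lambda>s t. basis (s \<otimes>\<^bsub>S\<^esub> t)) p q) = bilin (\<lambda>s t. basis (s \<otimes>\<^bsub>T\<^esub> t)) (?f p) (?f q)"
  proof (induction p rule: free_module_induct)
    case (basis s)
    from q show ?case
      by (induction q rule: free_module_induct)
        (simp_all add: mult basis lin_ext_add lin_ext_scale bilin_linear)
  qed (simp_all add: lin_ext_add lin_ext_scale bilin_linear)
  then show "?f (p \<otimes>\<^bsub>monoid_alg S\<^esub> q) = ?f p \<otimes>\<^bsub>monoid_alg T\<^esub> ?f q" by simp
qed (simp_all add: one lin_ext_add lin_ext_scale)


section \<open>The mixable shuffle algebra of a monoid algebra\<close>

context mixable_shuffle_algebra
begin

definition letter_prod :: "('a \<Rightarrow>\<^sub>0 'k) \<Rightarrow> ('a \<Rightarrow>\<^sub>0 'k) \<Rightarrow> ('a \<Rightarrow>\<^sub>0 'k)"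
  where "letter_prod p q = bilin (\<lambda>a b. basis (m a b)) p q"

text \<open>
  This is \<open>p \<otimes> x\<close> for a linear combination \<open>p\<close> of letters.
\<close>

definition prepend_lin :: "('a \<Rightarrow>\<^sub>0 'k) \<Rightarrow> ('a list \<Rightarrow>\<^sub>0 'k) \<Rightarrow> ('a list \<Rightarrow>\<^sub>0 'k)"
  where "prepend_lin p x = bilin (\<lambda>a w. basis (a # w)) p x"

text \<open>
  The pure tensor \<open>p\<^sub>1 \<otimes> \<dots> \<otimes> p\<^sub>n\<close>, written as a linear combination of words.
\<close>

definition expand :: "('a \<Rightarrow>\<^sub>0 'k) list \<Rightarrow> ('a list \<Rightarrow>\<^sub>0 'k)"
  where "expand ps = foldr prepend_lin ps (basis [])"

lemma expand_simps [simp]: "expand [] = basis []" "expand (p # ps) = prepend_lin p (expand ps)"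
  by (simp_all add: expand_def)

lemma prepend_lin_basis: "prepend_lin (basis a) x = prepend a x"
  by (simp add: prepend_lin_def bilin_basis_left prepend_def)

lemma prepend_lin_linear:
  "prepend_lin (p + q) x = prepend_lin p x + prepend_lin q x"
  "prepend_lin p (x + y) = prepend_lin p x + prepend_lin p y"
  "prepend_lin (scale c p) x = scale c (prepend_lin p x)"
  "prepend_lin p (scale c x) = scale c (prepend_lin p x)"
  "prepend_lin 0 x = 0" "prepend_lin p 0 = 0"
  by (simp_all add: prepend_lin_def bilin_linear)

lemma expand_basis [simp]: "expand (map basis w) = basis w"
  by (induction w) (simp_all add: prepend_lin_basis)

lemma shuffle_prod_prepend_lin:
  "prepend_lin p x \<diamondop> prepend_lin q y = prepend_lin p (x \<diamondop> prepend_lin q y)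
    + prepend_lin q (prepend_lin p x \<diamondop> y) + scale lam (prepend_lin (letter_prod p q) (x \<diamondop> y))"
proof (induction p rule: free_module_induct_UNIV)
  case (basis a)
  show ?case
  proof (induction q rule: free_module_induct_UNIV)
    case (basis b)
    show ?case by (simp add: prepend_lin_basis letter_prod_def shuffle_prod_prepend)
  next
    case zero
    show ?case by (simp add: shuffle_prod_linear prepend_lin_linear letter_prod_def)
  next
    case (add p q)
    then show ?case
      by (simp only: shuffle_prod_linear prepend_lin_linear letter_prod_def bilin_linear
        free_module.scale_right_distrib add_ac)
  next
    case (scale c p)
    then show ?case
      by (simp only: shuffle_prod_linear prepend_lin_linear letter_prod_def bilin_linear
        free_module.scale_right_distrib free_module.scale_scale mult.commute)
  qed
next
  case zero
  show ?case by (simp add: shuffle_prod_linear prepend_lin_linear letter_prod_def)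
next
  case (add p q)
  then show ?case
    by (simp only: shuffle_prod_linear prepend_lin_linear letter_prod_def bilin_linear
      free_module.scale_right_distrib add_ac)
next
  case (scale c p)
  then show ?case
    by (simp only: shuffle_prod_linear prepend_lin_linear letter_prod_def bilin_linear
      free_module.scale_right_distrib free_module.scale_scale mult.commute)
qed

lemma lin_ext_expand_prepend:
  "lin_ext expand (lin_ext (\<lambda>w. basis (p # w)) X) = prepend_lin p (lin_ext expand X)"
  by (simp add: lin_ext_lin_ext prepend_lin_def bilin_lin_ext_right)

lemma expand_mixable_shuffle:
  "lin_ext expand (mixable_shuffle letter_prod lam ps qs) = expand ps \<diamondop> expand qs"
proof (induction ps qs rule: word_pair_induct)
  case (Cons p ps q qs)
  show ?case
    unfolding mixable_shuffle.simps lin_ext_add lin_ext_scale lin_ext_expand_prepend Cons.IH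
    by (simp add: shuffle_prod_prepend_lin)
qed simp_all

lemma expand_mult:
  "lin_ext expand (bilin (mixable_shuffle letter_prod lam) X Y) = lin_ext expand X \<diamondop> lin_ext expand Y"
proof (induction X rule: free_module_induct_UNIV)
  case (basis ps)
  show ?case
    by (induction Y rule: free_module_induct_UNIV)
      (simp_all add: bilin_linear lin_ext_add lin_ext_scale shuffle_prod_linear expand_mixable_shuffle)
qed (simp_all add: bilin_linear lin_ext_add lin_ext_scale shuffle_prod_linear)

lemma supported_expand:
  "\<forall>p\<in>set ps. Poly_Mapping.keys p \<subseteq> C \<Longrightarrow> Poly_Mapping.keys (expand ps) \<subseteq> lists C"
proof (induction ps)
  case (Cons p ps)
  then show ?case unfolding expand_simps prepend_lin_def
    by (intro keys_bilin_subset[of _ C _ "lists C"]) auto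
qed simp

lemma expand_add: "expand (us @ (p + q) # vs) = expand (us @ p # vs) + expand (us @ q # vs)"
  by (induction us) (simp_all add: prepend_lin_linear)

lemma expand_scale: "expand (us @ scale c p # vs) = scale c (expand (us @ p # vs))"
  by (induction us) (simp_all add: prepend_lin_linear)

end

lemma mixable_shuffle_algebra_monoid:
  assumes "comm_monoid S"
  shows "mixable_shuffle_algebra (carrier S) (\<otimes>\<^bsub>S\<^esub>)"
proof -
  interpret comm_monoid S by fact
  show ?thesis by unfold_locales (rule m_closed m_comm m_assoc; assumption)+
qed

lemma subspace_multilinear_kernel: "free_module.subspace (multilinear_kernel A)"
  unfolding multilinear_kernel_def by (rule free_module.subspace_span)

text \<open>
  Expansion into words respects the products and kills the multilinearity relations.
  Conversely, modulo the relations each word over the monoid algebra is congruent to its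
  expansion, expanding one entry at a time; so the relations generate the whole kernel.
\<close>

lemma MS_monoid_alg:
  fixes S :: "('s, 'm) monoid_scheme" and lam :: "'k::comm_ring_1"
  assumes "comm_monoid S"
  defines "W \<equiv> basis_alg (lists (carrier S)) (mixable_shuffle (\<otimes>\<^bsub>S\<^esub>) lam) []"
  shows "alg_closed (MS lam (monoid_alg S :: ('k, 's \<Rightarrow>\<^sub>0 'k) module))"
    and "w \<in> lists (carrier S) \<Longrightarrow> MS_word lam S w \<in> carrier (MS lam (monoid_alg S))"
    and "\<exists>F\<in>alg_iso (MS lam (monoid_alg S)) W. \<forall>w\<in>lists (carrier S). F (MS_word lam S w) = basis w"
proof -
  interpret mixable_shuffle_algebra "carrier S" "(\<otimes>\<^bsub>S\<^esub>)" lam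
    using assms(1) by (rule mixable_shuffle_algebra_monoid)
  let ?C = "carrier S"
  let ?A = "monoid_alg S :: ('k, 's \<Rightarrow>\<^sub>0 'k) module"
  let ?K = "multilinear_kernel ?A"
  let ?P = "words_alg lam ?A"
  let ?B = "lists (carrier ?A)"
  have A_closed: "alg_closed ?A"
    using assms(1) by (simp add: alg_closed_monoid_alg comm_monoid.axioms(1))
  have letter: "(\<lambda>a b. a \<otimes>\<^bsub>?A\<^esub> b) = letter_prod"
    by (intro ext) (simp add: letter_prod_def)
  have P_eq: "?P = basis_alg ?B (mixable_shuffle letter_prod lam) []"
    by (simp only: words_alg_def letter)
  define h where "h = lin_ext expand"
  have linear: "h (p + q) = h p + h q" "h (scale c p) = scale c (h p)" "h (basis ps) = expand ps"
    "h (p - q) = h p - h q" for p q c ps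
    by (simp_all add: h_def lin_ext_add lin_ext_scale lin_ext_diff)
  define \<iota> where "\<iota> v = lin_ext (\<lambda>w. basis (v @ map (basis :: 's \<Rightarrow> 's \<Rightarrow>\<^sub>0 'k) w) :: _ \<Rightarrow>\<^sub>0 'k)" for v
  have rel_add: "basis (u @ (a + a') # v) - basis (u @ a # v) - basis (u @ a' # v) \<in> ?K"
    if "u \<in> ?B" "v \<in> ?B" "a \<in> carrier ?A" "a' \<in> carrier ?A" for u v a a'
  proof -
    have "basis (u @ (a \<oplus>\<^bsub>?A\<^esub> a') # v) - basis (u @ a # v) - basis (u @ a' # v) \<in> ?K"
      unfolding multilinear_kernel_def multilinear_relations_def
      using that by (intro free_module.span_base UnI1) blast
    then show ?thesis by simp
  qed
  have rel_scale: "basis (u @ scale c a # v) - scale c (basis (u @ a # v)) \<in> ?K"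
    if "u \<in> ?B" "v \<in> ?B" "a \<in> carrier ?A" for u v a c
  proof -
    have "basis (u @ (c \<odot>\<^bsub>?A\<^esub> a) # v) - scale c (basis (u @ a # v)) \<in> ?K"
      unfolding multilinear_kernel_def multilinear_relations_def
      using that by (intro free_module.span_base UnI2) blast
    then show ?thesis by simp
  qed
  have K_carrier: "?K \<subseteq> carrier ?P"
    unfolding multilinear_kernel_def P_eq basis_alg_simps
  proof (rule free_module.span_minimal[OF _ subspace_supported])
    show "multilinear_relations ?A \<subseteq> {p. Poly_Mapping.keys p \<subseteq> ?B}"
    proof
      fix x assume "x \<in> multilinear_relations ?A"
      then consider
        u v a a' where "x = basis (u @ (a + a') # v) - basis (u @ a # v) - basis (u @ a' # v)"
          "u \<in> ?B" "v \<in> ?B" "a \<in> carrier ?A" "a' \<in> carrier ?A"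
        | u v c a where "x = basis (u @ scale c a # v) - scale c (basis (u @ a # v))"
          "u \<in> ?B" "v \<in> ?B" "a \<in> carrier ?A"
        unfolding multilinear_relations_def monoid_alg_simps by blast
      then have "Poly_Mapping.keys x \<subseteq> ?B"
      proof cases
        case 1
        then have "a + a' \<in> carrier ?A" by (simp add: supported_closed)
        with 1 show ?thesis unfolding 1(1) by (intro supported_closed) simp_all
      next
        case 2
        then have "scale c a \<in> carrier ?A" by (simp add: supported_closed)
        with 2 show ?thesis unfolding 2(1) by (intro supported_closed) simp_all
      qed
      then show "x \<in> {p. Poly_Mapping.keys p \<subseteq> ?B}" by simp
    qed
  qed
  have h_K: "h k = 0" if "k \<in> ?K" for k
  proof -
    have "multilinear_relations ?A \<subseteq> {p. lin_ext expand p = 0}"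
      by (auto simp: multilinear_relations_def lin_ext_diff lin_ext_scale expand_add expand_scale)
    then have "?K \<subseteq> {p. lin_ext expand p = 0}"
      unfolding multilinear_kernel_def
      by (rule free_module.span_minimal[OF _ subspace_kernel_lin_ext])
    with that show ?thesis by (auto simp: h_def)
  qed
  have basis_B: "map (basis :: 's \<Rightarrow> 's \<Rightarrow>\<^sub>0 'k) w \<in> ?B" if "w \<in> lists ?C" for w
    using that by auto
  \<comment> \<open>The prefix \<open>v\<close> consists of the entries that have been expanded already.\<close>
  have reduce: "basis (v @ ps) - \<iota> v (expand ps) \<in> ?K" if "v \<in> ?B" "ps \<in> ?B" for v ps
    using that
  proof (induction ps arbitrary: v)
    case Nil
    then show ?case
      using free_module.subspace_0[OF subspace_multilinear_kernel] by (simp add: \<iota>_def)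
  next
    case (Cons p ps)
    then have p: "Poly_Mapping.keys p \<subseteq> ?C" and ps: "ps \<in> ?B" by auto
    have "basis (v @ p # ps) - lin_ext (\<lambda>s. basis (v @ basis s # ps)) p \<in> ?K"
      by (rule linear_mod_subspace[OF subspace_multilinear_kernel p])
        (use Cons.prems ps rel_add rel_scale in auto)
    moreover have "lin_ext (\<lambda>s. basis (v @ basis s # ps) - \<iota> (v @ [basis s]) (expand ps)) p \<in> ?K"
    proof (rule lin_ext_in_subspace[OF subspace_multilinear_kernel])
      fix s assume "s \<in> Poly_Mapping.keys p"
      then have "v @ [basis s] \<in> ?B" using p Cons.prems by auto
      from Cons.IH[OF this ps]
      show "basis (v @ basis s # ps) - \<iota> (v @ [basis s]) (expand ps) \<in> ?K" by simp
    qed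
    ultimately have "(basis (v @ p # ps) - lin_ext (\<lambda>s. basis (v @ basis s # ps)) p) +
        (lin_ext (\<lambda>s. basis (v @ basis s # ps) - \<iota> (v @ [basis s]) (expand ps)) p) \<in> ?K"
      by (rule free_module.subspace_add[OF subspace_multilinear_kernel])
    moreover have "lin_ext (\<lambda>s. \<iota> (v @ [basis s]) (expand ps)) p = \<iota> v (expand (p # ps))"
      by (simp add: \<iota>_def prepend_lin_def bilin_def lin_ext_lin_ext)
    ultimately show ?case by (simp add: lin_ext_fun_diff)
  qed
  have reduce': "p - \<iota> [] (h p) \<in> ?K" if "p \<in> carrier ?P" for p
  proof -
    have p: "Poly_Mapping.keys p \<subseteq> ?B" using that by (simp only: P_eq basis_alg_simps mem_Collect_eq)
    have "lin_ext (\<lambda>ps. basis ps - \<iota> [] (expand ps)) p \<in> ?K"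
    proof (rule lin_ext_in_subspace[OF subspace_multilinear_kernel])
      fix ps assume "ps \<in> Poly_Mapping.keys p"
      then have "ps \<in> ?B" using p by (rule subsetD[rotated])
      from reduce[OF _ this, of "[]"] show "basis ps - \<iota> [] (expand ps) \<in> ?K" by simp
    qed
    then show ?thesis by (simp add: lin_ext_fun_diff h_def \<iota>_def lin_ext_lin_ext)
  qed
  have "letter_prod p q \<in> carrier ?A" if "p \<in> carrier ?A" "q \<in> carrier ?A" for p q
    using A_closed that by (simp add: alg_closed_def letter[symmetric] del: monoid_alg_simps)
  then have P_closed: "alg_closed ?P"
    unfolding P_eq by (intro alg_closed_basis_alg keys_mixable_shuffle) simp_all
  have h_carrier: "h p \<in> carrier W" if "p \<in> carrier ?P" for p
  proof -
    have "Poly_Mapping.keys p \<subseteq> ?B" using that by (simp only: P_eq basis_alg_simps mem_Collect_eq)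
    then show ?thesis
      unfolding W_def basis_alg_simps mem_Collect_eq h_def
      by (rule keys_lin_ext_subset) (rule supported_expand, auto)
  qed
  have onto: "h ` carrier ?P = carrier W"
  proof
    show "h ` carrier ?P \<subseteq> carrier W" using h_carrier by (rule image_subsetI)
    show "carrier W \<subseteq> h ` carrier ?P"
    proof
      fix q assume "q \<in> carrier W"
      then have q: "Poly_Mapping.keys q \<subseteq> lists ?C" by (simp add: W_def)
      have "h (\<iota> [] q) = q" by (simp add: h_def \<iota>_def lin_ext_lin_ext)
      moreover have "\<iota> [] q \<in> carrier ?P"
        unfolding P_eq basis_alg_simps mem_Collect_eq \<iota>_def
        using q by (rule keys_lin_ext_subset) (use basis_B in simp)
      ultimately show "q \<in> h ` carrier ?P" by (metis imageI)
    qed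
  qed
  have kernel: "h p = h q \<longleftrightarrow> p - q \<in> ?K" if "p \<in> carrier ?P" "q \<in> carrier ?P" for p q
  proof
    assume "h p = h q"
    then have "h (p - q) = 0" by (simp add: linear)
    moreover have "p - q \<in> carrier ?P" using that by (simp add: P_eq supported_closed)
    ultimately show "p - q \<in> ?K" using reduce'[of "p - q"] by (simp add: \<iota>_def)
  next
    assume "p - q \<in> ?K"
    then have "h (p - q) = 0" by (rule h_K)
    then show "h p = h q" by (simp add: linear)
  qed
  have mult: "h (p \<otimes>\<^bsub>?P\<^esub> q) = h p \<otimes>\<^bsub>W\<^esub> h q" for p q
    by (simp add: P_eq W_def h_def expand_mult shuffle_prod_def)
  note quotient = quotient_basis_alg[OF P_eq P_closed K_carrier onto kernel]
  show "alg_closed (MS lam ?A)"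
    unfolding MS_def by (rule quotient) (simp_all add: mult, simp_all add: linear P_eq W_def)
  have "\<exists>F\<in>alg_iso (MS lam ?A) W. \<forall>p\<in>carrier ?P. F (?K +>\<^bsub>?P\<^esub> p) = h p"
    unfolding MS_def by (rule quotient) (simp_all add: mult, simp_all add: linear P_eq W_def)
  then obtain F where F: "F \<in> alg_iso (MS lam ?A) W" "\<forall>p\<in>carrier ?P. F (?K +>\<^bsub>?P\<^esub> p) = h p"
    by blast
  have word_P: "basis (map basis w) \<in> carrier ?P" if "w \<in> lists ?C" for w
    using basis_B[OF that] by (simp add: P_eq)
  show "MS_word lam S w \<in> carrier (MS lam ?A)" if "w \<in> lists ?C"
    unfolding MS_word_def MS_pure_def MS_def using word_P[OF that] by (rule coset_in_quotient_alg)
  have "F (MS_word lam S w) = basis w" if "w \<in> lists ?C" for w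
    using F(2) word_P[OF that] by (simp add: MS_word_def MS_pure_def linear)
  with F(1) show "\<exists>F\<in>alg_iso (MS lam ?A) W. \<forall>w\<in>lists ?C. F (MS_word lam S w) = basis w" by blast
qed


section \<open>The tensor product of monoid algebras\<close>

text \<open>
  The tensor \<open>p \<otimes> q\<close> in the free module on pairs of basis elements.
\<close>

definition free_tensor :: "('s \<Rightarrow>\<^sub>0 'k) \<Rightarrow> ('t \<Rightarrow>\<^sub>0 'k) \<Rightarrow> ('s \<times> 't \<Rightarrow>\<^sub>0 'k::comm_ring_1)"
  where "free_tensor p q = bilin (\<lambda>s t. basis (s, t)) p q"

lemma free_tensor_basis [simp]: "free_tensor (basis s) (basis t) = basis (s, t)"
  by (simp add: free_tensor_def)

lemma free_tensor_linear:
  "free_tensor (p + p') q = free_tensor p q + free_tensor p' q"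
  "free_tensor p (q + q') = free_tensor p q + free_tensor p q'"
  "free_tensor (scale c p) q = scale c (free_tensor p q)"
  "free_tensor p (scale c q) = scale c (free_tensor p q)"
  "free_tensor 0 q = 0" "free_tensor p 0 = 0"
  by (simp_all add: free_tensor_def bilin_linear)

lemma free_tensor_mult:
  fixes S :: "('s, 'm) monoid_scheme" and T :: "('t, 'n) monoid_scheme"
    and p p' :: "'s \<Rightarrow>\<^sub>0 'k::comm_ring_1"
  shows "free_tensor (p \<otimes>\<^bsub>monoid_alg S\<^esub> p') (q \<otimes>\<^bsub>monoid_alg T\<^esub> q') =
    free_tensor p q \<otimes>\<^bsub>monoid_alg (S \<times>\<times> T)\<^esub> free_tensor p' q'"
  unfolding monoid_alg_simps
proof (induction p rule: free_module_induct_UNIV)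
  case (basis s)
  show ?case
  proof (induction p' rule: free_module_induct_UNIV)
    case (basis s')
    show ?case
    proof (induction q rule: free_module_induct_UNIV)
      case (basis t)
      show ?case
        by (induction q' rule: free_module_induct_UNIV) (simp_all add: bilin_linear free_tensor_linear)
    qed (simp_all add: bilin_linear free_tensor_linear)
  qed (simp_all add: bilin_linear free_tensor_linear)
qed (simp_all add: bilin_linear free_tensor_linear)

lemma subspace_tensor_kernel: "free_module.subspace (tensor_kernel A B)"
  unfolding tensor_kernel_def by (rule free_module.subspace_span)

text \<open>
  Expand the first entry of a pure tensor in the basis \<open>S\<close> and the second one in the basis of
  \<open>B\<close> that corresponds to \<open>T\<close> under \<open>\<psi>\<close>. Modulo the relations every pure tensor is congruent
  to its expansion, so the kernel of the expansion map is generated by the relations.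
\<close>

lemma tensor_monoid_alg:
  fixes S :: "('s, 'm) monoid_scheme" and T :: "('t, 'n) monoid_scheme"
    and B :: "('k::comm_ring_1, 'b) module"
  assumes S: "Group.monoid S" and T: "Group.monoid T" and B: "alg_closed B"
    and \<psi>: "\<psi> \<in> alg_iso B (monoid_alg T)"
  shows "alg_closed (tensor_alg (monoid_alg S) B)"
    and "a \<in> carrier (monoid_alg S) \<Longrightarrow> b \<in> carrier B \<Longrightarrow>
      pure_tensor (monoid_alg S) B a b \<in> carrier (tensor_alg (monoid_alg S) B)"
    and "\<exists>F\<in>alg_iso (tensor_alg (monoid_alg S) B) (monoid_alg (S \<times>\<times> T)).
    \<forall>a\<in>carrier (monoid_alg S). \<forall>b\<in>carrier B. F (pure_tensor (monoid_alg S) B a b) = free_tensor a (\<psi> b)"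
proof -
  let ?A = "monoid_alg S :: ('k, 's \<Rightarrow>\<^sub>0 'k) module"
  let ?T = "monoid_alg T :: ('k, 't \<Rightarrow>\<^sub>0 'k) module"
  let ?D = "monoid_alg (S \<times>\<times> T) :: ('k, 's \<times> 't \<Rightarrow>\<^sub>0 'k) module"
  let ?K = "tensor_kernel ?A B"
  let ?P = "pairs_alg ?A B"
  let ?C = "carrier ?A \<times> carrier B"
  let ?m = "\<lambda>x y. basis (fst x \<otimes>\<^bsub>?A\<^esub> fst y, snd x \<otimes>\<^bsub>B\<^esub> snd y) :: _ \<Rightarrow>\<^sub>0 'k"
  define \<chi> where "\<chi> = inv_into (carrier B) \<psi>"
  note \<psi>D = alg_isoD[OF \<psi>]
  have \<chi>: "\<chi> \<in> alg_iso ?T B" unfolding \<chi>_def by (rule alg_iso_inv[OF B \<psi>])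
  note \<chi>D = alg_isoD[OF \<chi>]
  have \<psi>\<chi>: "\<psi> (\<chi> q) = q" if "q \<in> carrier ?T" for q
    using that \<psi>D(1) unfolding \<chi>_def by (simp add: bij_betw_def f_inv_into_f del: monoid_alg_simps)
  have \<chi>\<psi>: "\<chi> (\<psi> b) = b" if "b \<in> carrier B" for b
    using that \<psi>D(1) unfolding \<chi>_def by (simp add: bij_betw_def)
  have A: "alg_closed ?A" using S by (rule alg_closed_monoid_alg)
  have closed: "\<one>\<^bsub>?A\<^esub> \<in> carrier ?A" "\<one>\<^bsub>B\<^esub> \<in> carrier B"
    "\<And>a a' c. a \<in> carrier ?A \<Longrightarrow> a' \<in> carrier ?A \<Longrightarrow>
      a \<otimes>\<^bsub>?A\<^esub> a' \<in> carrier ?A \<and> a \<oplus>\<^bsub>?A\<^esub> a' \<in> carrier ?A \<and>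
      c \<odot>\<^bsub>?A\<^esub> a \<in> carrier ?A"
    "\<And>a a' c. a \<in> carrier B \<Longrightarrow> a' \<in> carrier B \<Longrightarrow>
      a \<otimes>\<^bsub>B\<^esub> a' \<in> carrier B \<and> a \<oplus>\<^bsub>B\<^esub> a' \<in> carrier B \<and>
      c \<odot>\<^bsub>B\<^esub> a \<in> carrier B"
    using A B unfolding alg_closed_def by blast+
  have P_eq: "?P = basis_alg ?C ?m (\<one>\<^bsub>?A\<^esub>, \<one>\<^bsub>B\<^esub>)"
    by (simp only: pairs_alg_def)
  have P_closed: "alg_closed ?P"
    unfolding P_eq by (rule alg_closed_basis_alg) (use closed in \<open>auto simp del: monoid_alg_simps\<close>)
  define h where "h = lin_ext (\<lambda>x. free_tensor (fst x :: 's \<Rightarrow>\<^sub>0 'k) (\<psi> (snd x)))"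
  define \<iota> where "\<iota> = lin_ext (\<lambda>x. basis (basis (fst x) :: 's \<Rightarrow>\<^sub>0 'k, \<chi> (basis (snd x))) :: _ \<Rightarrow>\<^sub>0 'k)"
  have linear: "h (p + q) = h p + h q" "h (scale c p) = scale c (h p)" "h (p - q) = h p - h q"
    "h (basis x) = free_tensor (fst x) (\<psi> (snd x))" for p q c x
    by (simp_all add: h_def lin_ext_add lin_ext_scale lin_ext_diff)
  have base: "x \<in> ?K" if "x \<in> tensor_relations ?A B" for x
    unfolding tensor_kernel_def using that by (rule free_module.span_base)
  have relations: "basis (a \<oplus>\<^bsub>?A\<^esub> a', b) - basis (a, b) - basis (a', b) \<in> ?K"
    "basis (a, b \<oplus>\<^bsub>B\<^esub> b') - basis (a, b) - basis (a, b') \<in> ?K"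
    "basis (c \<odot>\<^bsub>?A\<^esub> a, b) - scale c (basis (a, b)) \<in> ?K"
    "basis (a, c \<odot>\<^bsub>B\<^esub> b) - scale c (basis (a, b)) \<in> ?K"
    if "a \<in> carrier ?A" "a' \<in> carrier ?A" "b \<in> carrier B" "b' \<in> carrier B" for a a' b b' c
    using that by - (rule base, unfold tensor_relations_def, blast)+
  have relation_cases: thesis if "x \<in> tensor_relations ?A B"
    and "\<And>a a' b. x = basis (a \<oplus>\<^bsub>?A\<^esub> a', b) - basis (a, b) - basis (a', b) \<Longrightarrow>
      a \<in> carrier ?A \<Longrightarrow> a' \<in> carrier ?A \<Longrightarrow> b \<in> carrier B \<Longrightarrow> thesis"
    and "\<And>a b b'. x = basis (a, b \<oplus>\<^bsub>B\<^esub> b') - basis (a, b) - basis (a, b') \<Longrightarrow>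
      a \<in> carrier ?A \<Longrightarrow> b \<in> carrier B \<Longrightarrow> b' \<in> carrier B \<Longrightarrow> thesis"
    and "\<And>c a b. x = basis (c \<odot>\<^bsub>?A\<^esub> a, b) - scale c (basis (a, b)) \<Longrightarrow>
      a \<in> carrier ?A \<Longrightarrow> b \<in> carrier B \<Longrightarrow> thesis"
    and "\<And>c a b. x = basis (a, c \<odot>\<^bsub>B\<^esub> b) - scale c (basis (a, b)) \<Longrightarrow>
      a \<in> carrier ?A \<Longrightarrow> b \<in> carrier B \<Longrightarrow> thesis"
    for x thesis
    using that unfolding tensor_relations_def by blast
  have K_carrier: "?K \<subseteq> carrier ?P"
    unfolding tensor_kernel_def P_eq basis_alg_simps
  proof (rule free_module.span_minimal[OF _ subspace_supported], rule subsetI, unfold mem_Collect_eq)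
    fix x assume "x \<in> tensor_relations ?A B"
    then show "Poly_Mapping.keys x \<subseteq> ?C"
      by (rule relation_cases)
        (hypsubst, intro supported_closed; use closed in \<open>simp del: monoid_alg_simps\<close>)+
  qed
  have h_K: "h k = 0" if "k \<in> ?K" for k
  proof -
    have "tensor_relations ?A B \<subseteq> {p. h p = 0}"
    proof (rule subsetI, unfold mem_Collect_eq)
      fix x assume "x \<in> tensor_relations ?A B"
      then show "h x = 0"
        by (rule relation_cases) (simp_all add: linear free_tensor_linear \<psi>D)
    qed
    then have "?K \<subseteq> {p. h p = 0}"
      unfolding tensor_kernel_def h_def
      by (rule free_module.span_minimal[OF _ subspace_kernel_lin_ext])
    with that show ?thesis by auto
  qed
  have reduce: "basis (a, b) - \<iota> (free_tensor a (\<psi> b)) \<in> ?K"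
    if a: "a \<in> carrier ?A" and b: "b \<in> carrier B" for a b
  proof -
    let ?f = "\<lambda>s. lin_ext (\<lambda>t. basis (basis s, \<chi> (basis t))) (\<psi> b)"
    have "basis (a, b) - lin_ext (\<lambda>s. basis (basis s, b)) a \<in> ?K"
      by (rule linear_mod_subspace[OF subspace_tensor_kernel, of a "carrier S"])
        (use a b relations in auto)
    moreover have "lin_ext (\<lambda>s. basis (basis s, b) - ?f s) a \<in> ?K"
    proof (rule lin_ext_in_subspace[OF subspace_tensor_kernel])
      fix s assume "s \<in> Poly_Mapping.keys a"
      then have s: "basis s \<in> carrier ?A" using a by auto
      have "basis (basis s, \<chi> (\<psi> b)) - ?f s \<in> ?K"
      proof (rule linear_mod_subspace[OF subspace_tensor_kernel, of "\<psi> b" "carrier T"])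
        show "Poly_Mapping.keys (\<psi> b) \<subseteq> carrier T" using \<psi>D(6)[OF b] by simp
        fix x y :: "'t \<Rightarrow>\<^sub>0 'k" and c
        assume x: "Poly_Mapping.keys x \<subseteq> carrier T"
        then have x': "\<chi> x \<in> carrier B" using \<chi>D(6)[of x] by simp
        show "basis (basis s, \<chi> (scale c x)) - scale c (basis (basis s, \<chi> x)) \<in> ?K"
          using relations(4)[OF s s x' x'] \<chi>D(5)[of x c] x by simp
        assume y: "Poly_Mapping.keys y \<subseteq> carrier T"
        then have y': "\<chi> y \<in> carrier B" using \<chi>D(6)[of y] by simp
        show "basis (basis s, \<chi> (x + y)) - basis (basis s, \<chi> x) - basis (basis s, \<chi> y) \<in> ?K"
          using relations(2)[OF s s x' y'] \<chi>D(4)[of x y] x y by simp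
      qed
      then show "basis (basis s, b) - ?f s \<in> ?K" using \<chi>\<psi>[OF b] by simp
    qed
    ultimately have "(basis (a, b) - lin_ext (\<lambda>s. basis (basis s, b)) a) +
        lin_ext (\<lambda>s. basis (basis s, b) - ?f s) a \<in> ?K"
      by (rule free_module.subspace_add[OF subspace_tensor_kernel])
    moreover have "lin_ext ?f a = \<iota> (free_tensor a (\<psi> b))"
      by (simp add: \<iota>_def free_tensor_def bilin_def lin_ext_lin_ext)
    ultimately show ?thesis by (simp add: lin_ext_fun_diff)
  qed
  have reduce': "p - \<iota> (h p) \<in> ?K" if "p \<in> carrier ?P" for p
  proof -
    have p: "Poly_Mapping.keys p \<subseteq> ?C" using that by (simp only: P_eq basis_alg_simps mem_Collect_eq)
    have "lin_ext (\<lambda>x. basis x - \<iota> (free_tensor (fst x) (\<psi> (snd x)))) p \<in> ?K"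
    proof (rule lin_ext_in_subspace[OF subspace_tensor_kernel])
      fix x assume "x \<in> Poly_Mapping.keys p"
      then have "x \<in> ?C" using p by (rule subsetD[rotated])
      then show "basis x - \<iota> (free_tensor (fst x) (\<psi> (snd x))) \<in> ?K"
        using reduce[of "fst x" "snd x"] by (simp add: mem_Times_iff)
    qed
    then show ?thesis by (simp add: lin_ext_fun_diff h_def \<iota>_def lin_ext_lin_ext)
  qed
  have h_carrier: "h p \<in> carrier ?D" if "p \<in> carrier ?P" for p
  proof -
    have "Poly_Mapping.keys p \<subseteq> ?C" using that by (simp only: P_eq basis_alg_simps mem_Collect_eq)
    then have "Poly_Mapping.keys (h p) \<subseteq> carrier S \<times> carrier T"
      unfolding h_def
    proof (rule keys_lin_ext_subset)
      fix x assume x: "x \<in> ?C"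
      show "Poly_Mapping.keys (free_tensor (fst x) (\<psi> (snd x))) \<subseteq> carrier S \<times> carrier T"
        unfolding free_tensor_def
        by (rule keys_bilin_subset[of _ "carrier S" _ "carrier T"]) (use x \<psi>D(6)[of "snd x"] in auto)
    qed
    then show ?thesis by simp
  qed
  have onto: "h ` carrier ?P = carrier ?D"
  proof
    show "h ` carrier ?P \<subseteq> carrier ?D" using h_carrier by (rule image_subsetI)
    show "carrier ?D \<subseteq> h ` carrier ?P"
    proof
      fix q assume "q \<in> carrier ?D"
      then have q: "Poly_Mapping.keys q \<subseteq> carrier S \<times> carrier T" by simp
      have "h (\<iota> q) = lin_ext basis q"
        unfolding h_def \<iota>_def lin_ext_lin_ext
        by (rule lin_ext_cong[OF refl]) (use q \<psi>\<chi> in auto)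
      moreover have "\<iota> q \<in> carrier ?P"
        unfolding P_eq basis_alg_simps mem_Collect_eq \<iota>_def
        using q by (rule keys_lin_ext_subset) (use \<chi>D(6) in auto)
      ultimately show "q \<in> h ` carrier ?P" by (metis imageI lin_ext_basis_id)
    qed
  qed
  have kernel: "h p = h q \<longleftrightarrow> p - q \<in> ?K" if "p \<in> carrier ?P" "q \<in> carrier ?P" for p q
  proof
    assume "h p = h q"
    then have "h (p - q) = 0" by (simp add: linear)
    moreover have "p - q \<in> carrier ?P" using that by (simp add: P_eq supported_closed)
    ultimately show "p - q \<in> ?K" using reduce'[of "p - q"] by (simp add: \<iota>_def)
  next
    assume "p - q \<in> ?K"
    then have "h (p - q) = 0" by (rule h_K)
    then show "h p = h q" by (simp add: linear)
  qed
  have mult: "h (p \<otimes>\<^bsub>?P\<^esub> q) = h p \<otimes>\<^bsub>?D\<^esub> h q" if "p \<in> carrier ?P" "q \<in> carrier ?P" for p q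
  proof -
    have p: "Poly_Mapping.keys p \<subseteq> ?C" and q: "Poly_Mapping.keys q \<subseteq> ?C"
      using that by (simp_all only: P_eq basis_alg_simps mem_Collect_eq)
    from p have "h (bilin ?m p q) = h p \<otimes>\<^bsub>?D\<^esub> h q"
    proof (induction p rule: free_module_induct)
      case (basis x)
      from q show ?case
      proof (induction q rule: free_module_induct)
        case (basis y)
        have "\<psi> (snd x \<otimes>\<^bsub>B\<^esub> snd y) = \<psi> (snd x) \<otimes>\<^bsub>?T\<^esub> \<psi> (snd y)"
          by (rule \<psi>D(3)) (use \<open>x \<in> ?C\<close> \<open>y \<in> ?C\<close> in auto)
        then show ?case
          unfolding bilin_basis linear fst_conv snd_conv by (simp only: free_tensor_mult)
      qed (simp_all add: bilin_linear h_def lin_ext_add lin_ext_scale)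
    qed (simp_all add: bilin_linear h_def lin_ext_add lin_ext_scale)
    then show ?thesis by (simp only: P_eq basis_alg_simps)
  qed
  have one: "h \<one>\<^bsub>?P\<^esub> = \<one>\<^bsub>?D\<^esub>"
    by (simp add: P_eq linear \<psi>D(2))
  show "alg_closed (tensor_alg ?A B)"
    unfolding tensor_alg_def
    by (rule quotient_basis_alg(1)[OF P_eq P_closed K_carrier onto kernel one mult])
      (simp_all add: linear)
  have pure_P: "basis (a, b) \<in> carrier ?P" if "a \<in> carrier ?A" "b \<in> carrier B" for a b
    using that by (simp add: P_eq)
  show "pure_tensor ?A B a b \<in> carrier (tensor_alg ?A B)" if "a \<in> carrier ?A" "b \<in> carrier B"
    unfolding pure_tensor_def tensor_alg_def using pure_P[OF that] by (rule coset_in_quotient_alg)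
  have "\<exists>F\<in>alg_iso (tensor_alg ?A B) ?D. \<forall>p\<in>carrier ?P. F (?K +>\<^bsub>?P\<^esub> p) = h p"
    unfolding tensor_alg_def
    by (rule quotient_basis_alg(2)[OF P_eq P_closed K_carrier onto kernel one mult])
      (simp_all add: linear)
  then obtain F where F: "F \<in> alg_iso (tensor_alg ?A B) ?D" "\<forall>p\<in>carrier ?P. F (?K +>\<^bsub>?P\<^esub> p) = h p"
    by blast
  have "F (pure_tensor ?A B a b) = free_tensor a (\<psi> b)" if "a \<in> carrier ?A" "b \<in> carrier B" for a b
    using F(2) pure_P[OF that] by (simp add: pure_tensor_def linear)
  with F(1) show "\<exists>F\<in>alg_iso (tensor_alg ?A B) ?D.
      \<forall>a\<in>carrier ?A. \<forall>b\<in>carrier B. F (pure_tensor ?A B a b) = free_tensor a (\<psi> b)" by blast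
qed


section \<open>Tensor products of polynomial algebras\<close>

lemma free_comm_monoid_simps [simp]:
  "carrier (free_comm_monoid X) = {M. set_mset M \<subseteq> X}"
  "M \<otimes>\<^bsub>free_comm_monoid X\<^esub> N = M + N"
  "\<one>\<^bsub>free_comm_monoid X\<^esub> = {#}"
  by (simp_all add: free_comm_monoid_def)

lemma comm_monoid_free_comm_monoid: "comm_monoid (free_comm_monoid X)"
  by unfold_locales (auto simp: add_ac)

text \<open>
  Both tensor products are isomorphic to the monoid algebra of \<open>S \<times> T\<close>, and in both cases the
  isomorphism sends corresponding pure tensors to the same element.
\<close>

lemma tensor_alg_iso_right:
  fixes S :: "('s, 'm) monoid_scheme" and T :: "('t, 'n) monoid_scheme"
    and B :: "('k::comm_ring_1, 'b) module"
  assumes S: "Group.monoid S" and T: "Group.monoid T" and B: "alg_closed B"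
    and \<phi>: "\<phi> \<in> alg_iso (monoid_alg T) B"
  shows "\<exists>\<Phi>\<in>alg_iso (tensor_alg (monoid_alg S) (monoid_alg T)) (tensor_alg (monoid_alg S) B).
    \<forall>a\<in>carrier (monoid_alg S). \<forall>p\<in>carrier (monoid_alg T).
      \<Phi> (pure_tensor (monoid_alg S) (monoid_alg T) a p) = pure_tensor (monoid_alg S) B a (\<phi> p)"
proof -
  let ?A = "monoid_alg S :: ('k, 's \<Rightarrow>\<^sub>0 'k) module" and ?T = "monoid_alg T :: ('k, 't \<Rightarrow>\<^sub>0 'k) module"
  let ?D = "monoid_alg (S \<times>\<times> T) :: ('k, 's \<times> 't \<Rightarrow>\<^sub>0 'k) module"
  define \<psi> where "\<psi> = inv_into (carrier ?T) \<phi>"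
  have T_closed: "alg_closed ?T" using T by (rule alg_closed_monoid_alg)
  have \<psi>: "\<psi> \<in> alg_iso B ?T" unfolding \<psi>_def by (rule alg_iso_inv[OF T_closed \<phi>])
  have \<psi>\<phi>: "\<psi> (\<phi> p) = p" if "p \<in> carrier ?T" for p
    using alg_isoD(1)[OF \<phi>] that unfolding \<psi>_def bij_betw_def by (intro inv_into_f_f) blast+
  have id: "id \<in> alg_iso ?T ?T" by (rule alg_isoI) simp_all
  obtain F1 where F1: "F1 \<in> alg_iso (tensor_alg ?A ?T) ?D"
    "\<forall>a\<in>carrier ?A. \<forall>p\<in>carrier ?T. F1 (pure_tensor ?A ?T a p) = free_tensor a (id p)"
    using tensor_monoid_alg(3)[OF S T T_closed id] by blast
  obtain F2 where F2: "F2 \<in> alg_iso (tensor_alg ?A B) ?D"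
    "\<forall>a\<in>carrier ?A. \<forall>b\<in>carrier B. F2 (pure_tensor ?A B a b) = free_tensor a (\<psi> b)"
    using tensor_monoid_alg(3)[OF S T B \<psi>] by blast
  let ?G = "inv_into (carrier (tensor_alg ?A B)) F2"
  have "?G \<in> alg_iso ?D (tensor_alg ?A B)"
    by (rule alg_iso_inv[OF tensor_monoid_alg(1)[OF S T B \<psi>] F2(1)])
  with F1(1) have "?G \<circ> F1 \<in> alg_iso (tensor_alg ?A ?T) (tensor_alg ?A B)"
    by (rule alg_iso_compose)
  moreover have "(?G \<circ> F1) (pure_tensor ?A ?T a p) = pure_tensor ?A B a (\<phi> p)"
    if a: "a \<in> carrier ?A" and p: "p \<in> carrier ?T" for a p
  proof -
    have \<phi>p: "\<phi> p \<in> carrier B" using alg_isoD(6)[OF \<phi> p] .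
    have "F1 (pure_tensor ?A ?T a p) = F2 (pure_tensor ?A B a (\<phi> p))"
      using F1(2) F2(2) a p \<phi>p \<psi>\<phi>[OF p] by simp
    moreover have "pure_tensor ?A B a (\<phi> p) \<in> carrier (tensor_alg ?A B)"
      by (rule tensor_monoid_alg(2)[OF S T B \<psi> a \<phi>p])
    ultimately show ?thesis
      using alg_isoD(1)[OF F2(1)] by (simp add: bij_betw_def)
  qed
  ultimately show ?thesis by blast
qed

text \<open>
  The tensor product is the monoid algebra of pairs of multisets over \<open>X\<close> and \<open>L\<close>. Its
  isomorphism \<open>F\<close> sends the generators to the pairs \<open>({#x#}, {#})\<close> and \<open>({#}, {#l#})\<close>. These
  pairs are distinct, so the generators are distinct, and a multiset of generators is the same
  as a pair of multisets.
\<close>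

lemma polynomial_alg_tensor:
  fixes X :: "'x set" and L :: "'l set" and B :: "('k::comm_ring_1, 'b) module"
  assumes B: "alg_closed B" and \<phi>: "\<phi> \<in> alg_iso (polynomial_alg L) B"
  shows "is_polynomial_alg_on (tensor_alg (polynomial_alg X) B)
    ({pure_tensor (polynomial_alg X) B (variable x) \<one>\<^bsub>B\<^esub> | x. x \<in> X} \<union>
     {pure_tensor (polynomial_alg X) B \<one>\<^bsub>polynomial_alg X\<^esub> (\<phi> (variable l)) | l. l \<in> L})"
    (is "is_polynomial_alg_on _ ?Y")
proof -
  let ?S = "free_comm_monoid X" and ?T = "free_comm_monoid L"
  let ?A = "polynomial_alg X :: ('k, 'x multiset \<Rightarrow>\<^sub>0 'k) module"
  let ?L = "polynomial_alg L :: ('k, 'l multiset \<Rightarrow>\<^sub>0 'k) module"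
  let ?D = "monoid_alg (?S \<times>\<times> ?T) :: ('k, 'x multiset \<times> 'l multiset \<Rightarrow>\<^sub>0 'k) module"
  let ?R = "tensor_alg ?A B"
  have S: "Group.monoid ?S" and T: "Group.monoid ?T"
    using comm_monoid_free_comm_monoid comm_monoid.axioms(1) by blast+
  have L_closed: "alg_closed ?L" using T by (rule alg_closed_monoid_alg)
  define \<psi> where "\<psi> = inv_into (carrier ?L) \<phi>"
  have \<psi>: "\<psi> \<in> alg_iso B ?L" unfolding \<psi>_def by (rule alg_iso_inv[OF L_closed \<phi>])
  have \<psi>\<phi>: "\<psi> (\<phi> p) = p" if "p \<in> carrier ?L" for p
    using alg_isoD(1)[OF \<phi>] that unfolding \<psi>_def bij_betw_def by (intro inv_into_f_f) blast+
  obtain F where F: "F \<in> alg_iso ?R ?D"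
    "\<forall>a\<in>carrier ?A. \<forall>b\<in>carrier B. F (pure_tensor ?A B a b) = free_tensor a (\<psi> b)"
    using tensor_monoid_alg(3)[OF S T B \<psi>] by blast
  have R_closed: "alg_closed ?R" by (rule tensor_monoid_alg(1)[OF S T B \<psi>])
  define j1 where "j1 x = pure_tensor ?A B (variable x) \<one>\<^bsub>B\<^esub>" for x
  define j2 where "j2 l = pure_tensor ?A B \<one>\<^bsub>?A\<^esub> (\<phi> (variable l))" for l
  have Y: "?Y = j1 ` X \<union> j2 ` L" by (auto simp: j1_def j2_def)
  have oneB: "\<one>\<^bsub>B\<^esub> \<in> carrier B" using B by (simp add: alg_closed_def)
  have \<phi>l: "\<phi> (variable l) \<in> carrier B" if "l \<in> L" for l
    using alg_isoD(6)[OF \<phi>] that by simp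
  have F_j1: "F (j1 x) = basis ({#x#}, {#})" if "x \<in> X" for x
  proof -
    have "F (j1 x) = free_tensor (variable x) (\<psi> \<one>\<^bsub>B\<^esub>)"
      unfolding j1_def by (rule F(2)[rule_format]) (use that oneB in simp_all)
    also have "\<psi> \<one>\<^bsub>B\<^esub> = basis {#}"
      using alg_isoD(2)[OF \<psi>] by (simp only: monoid_alg_simps free_comm_monoid_simps)
    finally show ?thesis by (simp only: free_tensor_basis)
  qed
  have F_j2: "F (j2 l) = basis ({#}, {#l#})" if "l \<in> L" for l
  proof -
    have "F (j2 l) = free_tensor \<one>\<^bsub>?A\<^esub> (\<psi> (\<phi> (variable l)))"
      unfolding j2_def by (rule F(2)[rule_format]) (use that \<phi>l in simp_all)
    also have "\<psi> (\<phi> (variable l)) = variable l" using that by (intro \<psi>\<phi>) simp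
    finally show ?thesis by (simp only: monoid_alg_simps free_comm_monoid_simps free_tensor_basis)
  qed
  have Y_carrier: "?Y \<subseteq> carrier ?R"
    unfolding Y
  proof safe
    show "j1 x \<in> carrier ?R" if "x \<in> X" for x
      unfolding j1_def by (rule tensor_monoid_alg(2)[OF S T B \<psi>]) (use that oneB in simp_all)
    show "j2 l \<in> carrier ?R" if "l \<in> L" for l
      unfolding j2_def by (rule tensor_monoid_alg(2)[OF S T B \<psi>]) (use that \<phi>l in simp_all)
  qed
  \<comment> \<open>\<open>d y\<close> is the pair of multisets that corresponds to the generator \<open>y\<close>.\<close>
  define d where "d y = (SOME k. F y = basis k)" for y
  have d: "d y = k" if "F y = basis k" for y k
    unfolding d_def by (rule some_equality[of "\<lambda>k. F y = basis k"]) (use that in \<open>simp_all add: basis_inject\<close>)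
  define \<mu> where "\<mu> N = (\<Sum>y\<in>#N. fst (d y), \<Sum>y\<in>#N. snd (d y))" for N
  define \<nu> where "\<nu> M = image_mset j1 (fst M) + image_mset j2 (snd M)" for M
  have \<mu>_add: "\<mu> (M + N) = (fst (\<mu> M) + fst (\<mu> N), snd (\<mu> M) + snd (\<mu> N))" for M N
    by (simp add: \<mu>_def)
  have \<mu>_single: "\<mu> {#y#} = d y" for y by (simp add: \<mu>_def)
  have \<mu>_j1: "\<mu> (image_mset j1 M) = (M, {#})" if "set_mset M \<subseteq> X" for M
    using that
  proof (induction M)
    case (add x M)
    then show ?case using \<mu>_add[of "{#j1 x#}" "image_mset j1 M"] d[OF F_j1[of x]] by (simp add: \<mu>_single)
  qed (simp add: \<mu>_def)
  have \<mu>_j2: "\<mu> (image_mset j2 M) = ({#}, M)" if "set_mset M \<subseteq> L" for M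
    using that
  proof (induction M)
    case (add l M)
    then show ?case using \<mu>_add[of "{#j2 l#}" "image_mset j2 M"] d[OF F_j2[of l]] by (simp add: \<mu>_single)
  qed (simp add: \<mu>_def)
  have \<mu>: "\<mu> N \<in> carrier (?S \<times>\<times> ?T) \<and> \<nu> (\<mu> N) = N" if "set_mset N \<subseteq> ?Y" for N
    using that
  proof (induction N)
    case empty
    then show ?case by (simp add: \<mu>_def \<nu>_def)
  next
    case (add y N)
    then have IH: "\<mu> N \<in> carrier (?S \<times>\<times> ?T)" "\<nu> (\<mu> N) = N" and "y \<in> ?Y" by simp_all
    from \<open>y \<in> ?Y\<close> have y: "d y \<in> carrier (?S \<times>\<times> ?T)" "\<nu> (d y) = {#y#}"
      unfolding Y using d[OF F_j1] d[OF F_j2] by (auto simp: \<nu>_def)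
    have eq: "\<mu> (add_mset y N) = (fst (d y) + fst (\<mu> N), snd (d y) + snd (\<mu> N))"
      using \<mu>_add[of "{#y#}" N] by (simp add: \<mu>_single)
    have "\<nu> (\<mu> (add_mset y N)) = \<nu> (d y) + \<nu> (\<mu> N)"
      unfolding eq by (simp add: \<nu>_def add_ac)
    then show ?case using IH y unfolding eq by (auto simp: mem_Times_iff)
  qed
  have "bij_betw \<mu> (carrier (free_comm_monoid ?Y)) (carrier (?S \<times>\<times> ?T))"
  proof (rule bij_betw_byWitness[where f' = \<nu>])
    show "\<forall>N\<in>carrier (free_comm_monoid ?Y). \<nu> (\<mu> N) = N" using \<mu> by simp
    show "\<mu> ` carrier (free_comm_monoid ?Y) \<subseteq> carrier (?S \<times>\<times> ?T)"
      using \<mu> by (intro image_subsetI) simp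
    show "\<forall>M\<in>carrier (?S \<times>\<times> ?T). \<mu> (\<nu> M) = M"
      using \<mu>_j1 \<mu>_j2 by (auto simp: \<nu>_def \<mu>_add)
    show "\<nu> ` carrier (?S \<times>\<times> ?T) \<subseteq> carrier (free_comm_monoid ?Y)"
      unfolding Y by (intro image_subsetI) (fastforce simp: \<nu>_def)
  qed
  then have E: "lin_ext (\<lambda>N. basis (\<mu> N)) \<in> alg_iso (polynomial_alg ?Y) ?D"
    by (rule monoid_alg_iso) (simp add: \<mu>_def, simp add: \<mu>_add mult_DirProd' case_prod_beta)
  let ?G = "inv_into (carrier ?R) F"
  have "?G \<circ> lin_ext (\<lambda>N. basis (\<mu> N)) \<in> alg_iso (polynomial_alg ?Y) ?R"
    by (rule alg_iso_compose[OF E alg_iso_inv[OF R_closed F(1)]])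
  moreover have "(?G \<circ> lin_ext (\<lambda>N. basis (\<mu> N))) (variable y) = y" if "y \<in> ?Y" for y
  proof -
    have "basis (d y) = F y"
      using that d[OF F_j1] d[OF F_j2] F_j1 F_j2 unfolding Y by auto
    moreover have "y \<in> carrier ?R" using that Y_carrier by blast
    ultimately show ?thesis
      using alg_isoD(1)[OF F(1)] by (simp add: \<mu>_single bij_betw_def)
  qed
  ultimately show ?thesis
    unfolding is_polynomial_alg_on_def using Y_carrier by blast
qed


section \<open>Mixable shuffle algebras over ordered monoids\<close>

text \<open>
  The lexicographic order is a linear order on all words only if all letters are comparable.
  Letters outside \<open>C\<close> are put above those of \<open>C\<close> and well-ordered among themselves.
\<close>

lemma extend_linear_order:
  assumes "linear_order_on C r"
  shows "\<exists>R. alphabet_order R \<and> (\<forall>a\<in>C. \<forall>b\<in>C. (a, b) \<in> R \<longleftrightarrow> (a, b) \<in> r - Id)"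
proof -
  obtain w :: "'a rel" where w: "well_order_on UNIV w" using well_order_on by blast
  have r: "trans r" "antisym r" "total_on C r"
    using assms by (auto simp: order_on_defs)
  have w': "trans w" "antisym w" "total w"
    using w by (auto simp: order_on_defs)
  define R where "R = {(a, b). a \<noteq> b \<and> (if a \<in> C then b \<in> C \<longrightarrow> (a, b) \<in> r else b \<notin> C \<and> (a, b) \<in> w)}"
  have "alphabet_order R"
  proof
    show "trans R"
    proof (rule transI)
      fix x y z assume xy: "(x, y) \<in> R" and yz: "(y, z) \<in> R"
      then have "x \<noteq> z"
        using r(2) w'(2) by (auto simp: R_def antisym_def split: if_splits)
      then show "(x, z) \<in> R"
        using xy yz transD[OF r(1), of x y z] transD[OF w'(1), of x y z]
        by (auto simp: R_def split: if_splits)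
    qed
    show "(a, a) \<notin> R" for a by (simp add: R_def)
    show "a \<noteq> b \<Longrightarrow> (a, b) \<in> R \<or> (b, a) \<in> R" for a b
      using r(3) w'(3) by (auto simp: R_def total_on_def)
  qed
  moreover have "\<forall>a\<in>C. \<forall>b\<in>C. (a, b) \<in> R \<longleftrightarrow> (a, b) \<in> r - Id"
    by (auto simp: R_def)
  ultimately show ?thesis by blast
qed

lemma lexord_restrict:
  assumes "\<And>a b. a \<in> C \<Longrightarrow> b \<in> C \<Longrightarrow> (a, b) \<in> R \<longleftrightarrow> (a, b) \<in> R'"
  shows "u \<in> lists C \<Longrightarrow> v \<in> lists C \<Longrightarrow> (u, v) \<in> lexord R \<longleftrightarrow> (u, v) \<in> lexord R'"
proof (induction u arbitrary: v)
  case (Cons a u)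
  then show ?case using assms by (cases v) auto
qed simp

text \<open>
  Both algebras are identified with the free module on the words over \<open>S\<close>: the polynomial
  algebra by evaluation at the Lyndon words, the mixable shuffle algebra by expansion.
\<close>

lemma MS_polynomial_alg:
  fixes S :: "('s, 'm) monoid_scheme" and lam :: "'k::linordered_field"
  assumes S: "comm_monoid S" and r: "linear_order_on (carrier S) r"
  shows "\<exists>\<phi>\<in>alg_iso (polynomial_alg (Lyn S r)) (MS lam (monoid_alg S)).
    \<forall>w\<in>Lyn S r. \<phi> (variable w) = MS_word lam S w"
proof -
  let ?C = "carrier S"
  let ?M = "MS lam (monoid_alg S :: ('k, 's \<Rightarrow>\<^sub>0 'k) module)"
  let ?W = "basis_alg (lists ?C) (mixable_shuffle (\<otimes>\<^bsub>S\<^esub>) lam) []"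
  obtain R where R: "alphabet_order R" "\<forall>a\<in>?C. \<forall>b\<in>?C. (a, b) \<in> R \<longleftrightarrow> (a, b) \<in> r - Id"
    using extend_linear_order[OF r] by blast
  interpret mixable_shuffle_algebra ?C "(\<otimes>\<^bsub>S\<^esub>)" lam
    using S by (rule mixable_shuffle_algebra_monoid)
  interpret alphabet_order R by fact
  interpret ordered_mixable_shuffle_algebra ?C "(\<otimes>\<^bsub>S\<^esub>)" lam R ..
  have lexord: "(w, v) \<in> lexord R \<longleftrightarrow> (w, v) \<in> lexord (r - Id)" if "w \<in> lists ?C" "w = u @ v" for u v w
    by (rule lexord_restrict[of ?C]) (use R(2) that in simp_all)
  have Lyn_eq: "Lyn S r = lyndon_words"
    unfolding Lyn_def lyndon_words_def lyndon_def word_less_def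
    by (rule Collect_cong) (use lexord in metis)
  have Lyn: "carrier (free_comm_monoid (Lyn S r)) = lyndon_monomials"
    by (simp add: Lyn_eq lyndon_monomials_def)
  have word: "w \<in> lists ?C" if "w \<in> Lyn S r" for w
    using that unfolding Lyn_eq lyndon_words_def by simp
  have eval: "shuffle_eval \<in> alg_iso (polynomial_alg (Lyn S r)) ?W"
  proof (rule alg_isoI)
    show "bij_betw shuffle_eval (carrier (polynomial_alg (Lyn S r))) (carrier ?W)"
      unfolding monoid_alg_simps(1) basis_alg_simps(1) Lyn bij_betw_def
      using shuffle_eval_inj shuffle_eval_surj unfolding supported_def by (rule conjI)
    show "shuffle_eval \<one>\<^bsub>polynomial_alg (Lyn S r)\<^esub> = \<one>\<^bsub>?W\<^esub>"
      using shuffle_mset_mset[of "[]"]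
      unfolding monoid_alg_simps basis_alg_simps free_comm_monoid_simps shuffle_eval_basis by simp
    fix p q :: "'s list multiset \<Rightarrow>\<^sub>0 'k" and c
    assume "p \<in> carrier (polynomial_alg (Lyn S r))" "q \<in> carrier (polynomial_alg (Lyn S r))"
    then show "shuffle_eval (p \<otimes>\<^bsub>polynomial_alg (Lyn S r)\<^esub> q) = shuffle_eval p \<otimes>\<^bsub>?W\<^esub> shuffle_eval q"
      using shuffle_eval_mult[of p q] unfolding monoid_alg_simps(1) Lyn
      by (simp add: shuffle_prod_def)
  qed (simp_all add: shuffle_eval_add shuffle_eval_scale)
  obtain F where F: "F \<in> alg_iso ?M ?W" "\<forall>w\<in>lists ?C. F (MS_word lam S w) = basis w"
    using MS_monoid_alg(3)[OF S] by blast
  let ?G = "inv_into (carrier ?M) F"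
  have "?G \<circ> shuffle_eval \<in> alg_iso (polynomial_alg (Lyn S r)) ?M"
    by (rule alg_iso_compose[OF eval alg_iso_inv[OF MS_monoid_alg(1)[OF S] F(1)]])
  moreover have "(?G \<circ> shuffle_eval) (variable w) = MS_word lam S w" if "w \<in> Lyn S r" for w
  proof -
    have "shuffle_eval (variable w) = F (MS_word lam S w)"
      using F(2) word[OF that] by (simp add: shuffle_mset_single)
    then show ?thesis
      using alg_isoD(1)[OF F(1)] MS_monoid_alg(2)[OF S word[OF that], of lam] by (simp add: bij_betw_def)
  qed
  ultimately show ?thesis by blast
qed

theorem theorem2p4:
  fixes S :: "('s, 'm) monoid_scheme" and r :: "('s \<times> 's) set"
    and X :: "'x set" and rX :: "('x \<times> 'x) set" and rM :: "('x multiset \<times> 'x multiset) set"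
    and lam :: rat
  shows
    "(comm_monoid S \<and> linear_order_on (carrier S) r \<longrightarrow>
       (let QS = (monoid_alg S :: (rat, 's \<Rightarrow>\<^sub>0 rat) module);
            QLyn = (polynomial_alg (Lyn S r) :: (rat, 's list multiset \<Rightarrow>\<^sub>0 rat) module)
        in \<exists>\<phi> \<Phi>. \<phi> \<in> alg_iso QLyn (MS lam QS)
             \<and> (\<forall>w \<in> Lyn S r. \<phi> (variable w) = MS_word lam S w)
             \<and> \<Phi> \<in> alg_iso (tensor_alg QS QLyn) (Sha lam QS)
             \<and> (\<forall>a \<in> carrier QS. \<forall>p \<in> carrier QLyn.
                  \<Phi> (pure_tensor QS QLyn a p) = Sha_pure lam QS a (\<phi> p))))
     \<and>
     (linear_order_on X rX \<and> linear_order_on (carrier (free_comm_monoid X)) rM \<longrightarrow>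
       is_polynomial_alg_on (Sha lam (polynomial_alg X)) (Lyn_bar lam X rM))"
proof (intro conjI impI; elim conjE)
  assume S: "comm_monoid S" and r: "linear_order_on (carrier S) r"
  let ?QS = "monoid_alg S :: (rat, 's \<Rightarrow>\<^sub>0 rat) module"
  let ?QLyn = "polynomial_alg (Lyn S r) :: (rat, 's list multiset \<Rightarrow>\<^sub>0 rat) module"
  obtain \<phi> where \<phi>: "\<phi> \<in> alg_iso ?QLyn (MS lam ?QS)"
    "\<forall>w\<in>Lyn S r. \<phi> (variable w) = MS_word lam S w"
    using MS_polynomial_alg[OF S r] by blast
  obtain \<Phi> where "\<Phi> \<in> alg_iso (tensor_alg ?QS ?QLyn) (Sha lam ?QS)"
    "\<forall>a\<in>carrier ?QS. \<forall>p\<in>carrier ?QLyn. \<Phi> (pure_tensor ?QS ?QLyn a p) = Sha_pure lam ?QS a (\<phi> p)"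
    unfolding Sha_def Sha_pure_def
    using tensor_alg_iso_right[OF comm_monoid.axioms(1)[OF S]
        comm_monoid.axioms(1)[OF comm_monoid_free_comm_monoid] MS_monoid_alg(1)[OF S] \<phi>(1)] by blast
  with \<phi> show "let QS = ?QS; QLyn = ?QLyn in \<exists>\<phi> \<Phi>. \<phi> \<in> alg_iso QLyn (MS lam QS)
      \<and> (\<forall>w \<in> Lyn S r. \<phi> (variable w) = MS_word lam S w)
      \<and> \<Phi> \<in> alg_iso (tensor_alg QS QLyn) (Sha lam QS)
      \<and> (\<forall>a \<in> carrier QS. \<forall>p \<in> carrier QLyn. \<Phi> (pure_tensor QS QLyn a p) = Sha_pure lam QS a (\<phi> p))"
    unfolding Let_def by blast
next
  assume rM: "linear_order_on (carrier (free_comm_monoid X)) rM"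
  let ?S = "free_comm_monoid X"
  obtain \<phi> where \<phi>: "\<phi> \<in> alg_iso (polynomial_alg (Lyn ?S rM)) (MS lam (polynomial_alg X))"
    "\<forall>w\<in>Lyn ?S rM. \<phi> (variable w) = MS_word lam ?S w"
    using MS_polynomial_alg[OF comm_monoid_free_comm_monoid rM] by blast
  have "Lyn_bar lam X rM =
      {pure_tensor (polynomial_alg X) (MS lam (polynomial_alg X)) (variable x)
         \<one>\<^bsub>MS lam (polynomial_alg X)\<^esub> | x. x \<in> X} \<union>
      {pure_tensor (polynomial_alg X) (MS lam (polynomial_alg X)) \<one>\<^bsub>polynomial_alg X\<^esub>
         (\<phi> (variable w)) | w. w \<in> Lyn ?S rM}"
    unfolding Lyn_bar_def Sha_pure_def using \<phi>(2) by (intro arg_cong2[of _ _ _ _ "(\<union>)"] refl Collect_cong) metis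
  then show "is_polynomial_alg_on (Sha lam (polynomial_alg X)) (Lyn_bar lam X rM)"
    unfolding Sha_def
    using polynomial_alg_tensor[OF MS_monoid_alg(1)[OF comm_monoid_free_comm_monoid] \<phi>(1)] by simp
qed

end
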